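(* The category $\mathsf{WHB}$ of WHB-algebras with algebra homomorphisms is dually equivalent to the category $\mathsf{WHBS}$ of WHB-spaces with WHBS-morphisms. The dual equivalence is given by the contravariant functors $\mathrm{X}\colon \mathsf{WHB}\to\mathsf{WHBS}$ and $\mathrm{D}\colon \mathsf{WHBS}\to\mathsf{WHB}$ described below, with natural isomorphisms $\sigma\colon \mathrm{I}_{\mathsf{WHB}}\to \mathrm{D}\circ\mathrm{X}$ and $\epsilon\colon \mathrm{I}_{\mathsf{WHBS}}\to\mathrm{X}\circ\mathrm{D}$ given by $\sigma_{\mathbf{A}}(a)=\{P\in X(\mathbf{A})\colon a\in P\}$ and $\epsilon_X(x)=\{U\in D(X)\colon x\in U\}$.
   Context: A WH-algebra is an algebra $(A,\wedge,\vee,\to,0,1)$ such that $(A,\wedge,\vee,0,1)$ is a bounded distributive lattice and for all $a,b,c$: $a\to a=1$; $a\to(b\wedge c)=(a\to b)\wedge(a\to c)$; $(a\vee b)\to c=(a\to c)\wedge(b\to c)$; $(a\to b)\wedge(b\to c)\le a\to c$. A WD-algebra is an algebra $(A,\wedge,\vee,\leftarrow,0,1)$ with bounded distributive lattice reduct such that for all $a,b,c$: $a\leftarrow a=0$; $(a\vee b)\leftarrow c=(a\leftarrow c)\vee(b\leftarrow c)$; $a\leftarrow(b\wedge c)=(a\leftarrow b)\vee(a\leftarrow c)$; $a\leftarrow c\le(a\leftarrow b)\vee(b\leftarrow c)$. A WHB-algebra is an algebra $(A,\wedge,\vee,\to,\leftarrow,0,1)$ whose $\to$-reduct is a WH-algebra,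 whose $\leftarrow$-reduct is a WD-algebra, and which satisfies for all $a,b$: (E1) $a\wedge((a\to b)\leftarrow 0)\le b$ and (E2) $a\le b\vee(1\to(a\leftarrow b))$. For a relation $\mathcal R$ on $X$, $\mathcal R(x)=\{y\colon (x,y)\in\mathcal R\}$ and $\mathcal R^{-1}(U)=\{x\colon \mathcal R(x)\cap U\neq\emptyset\}$. A WHB-frame is $(X,\le,R,S)$ with $\le$ a partial order and $R,S$ binary relations on $X$ such that: if $x\le y$ and $(y,z)\in R$ then $(x,z)\in R$; if $x\le y$ and $(x,z)\in S$ then $(y,z)\in S$; and $S=R^{-1}$ (i.e. $(x,y)\in S$ iff $(y,x)\in R$). For upsets $U,V$ put $U\Rightarrow_R V=\{x\colon R(x)\cap U\subseteq V\}$ and $U\Leftarrow_S V=\{x\colon S(x)\cap(U\setminus V)\neq\emptyset\}$. A WHB-space is $(X,\tau,\le,R,S)$ such that $(X,\tau,\le)$ is a Priestley space, $(X,\le,R,S)$ is a WHB-frame, $R(x)$ and $S(x)$ are $\tau$-closed for every $x$, and $R^{-1}(U)$, $S^{-1}(U)$ are clopen for every clopen $U$. A WHBS-morphism $f\colon (X_1,\tau_1,\le_1,R_1,S_1)\to(X_2,\tau_2,\le_2,R_2,S_2)$ is a continuous order-preserving map such that for $\mathcal R\in\{R,S\}$: $(x,y)\in\mathcal R_1$ implies $(f(x),f(y))\in\mathcal R_2$; and if $(f(x),z)\in\mathcal R_2$ then there is $y\in\mathcal R_1(x)$ with $f(y)=z$. For a WHB-space $X$, $\mathrm{D}(X)=(D(X),\cap,\cup,\Rightarrow_R,\Leftarrow_S,\emptyset,X)$,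 where $D(X)$ is the set of clopen upsets; for a morphism $f$, $\mathrm{D}(f)(U)=f^{-1}(U)$. For a WHB-algebra $\mathbf A$, $X(\mathbf A)$ is the set of prime filters, $\tau_{\mathbf A}$ the topology with subbase $\{\sigma_{\mathbf A}(a)\}\cup\{X(\mathbf A)\setminus\sigma_{\mathbf A}(a)\}$, $(P,Q)\in R_{\mathbf A}$ iff for all $a,b$ ($a\to b\in P$ and $a\in Q$ imply $b\in Q$), $(P,Q)\in S_{\mathbf A}$ iff for all $a,b$ ($a\in Q$ and $b\notin Q$ imply $a\leftarrow b\in P$), and $\mathrm X(\mathbf A)=(X(\mathbf A),\tau_{\mathbf A},\subseteq,R_{\mathbf A},S_{\mathbf A})$; for a homomorphism $h\colon\mathbf A_1\to\mathbf A_2$, $\mathrm X(h)(P)=h^{-1}(P)$. *)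

theory Defs
  imports "HOL-Analysis.Analysis"
begin

record 'a alg_sig =
  acar  :: "'a set"
  ameet :: "'a \<Rightarrow> 'a \<Rightarrow> 'a"
  ajoin :: "'a \<Rightarrow> 'a \<Rightarrow> 'a"
  aimp  :: "'a \<Rightarrow> 'a \<Rightarrow> 'a"
  acoimp :: "'a \<Rightarrow> 'a \<Rightarrow> 'a"
  azero :: 'a
  aone  :: 'a

definition alg_le :: "'a alg_sig \<Rightarrow> 'a \<Rightarrow> 'a \<Rightarrow> bool" where
  "alg_le A a b \<longleftrightarrow> ameet A a b = a"

definition bdl :: "'a alg_sig \<Rightarrow> bool" where
  "bdl A \<longleftrightarrow>
     azero A \<in> acar A \<and> aone A \<in> acar A \<and>
     (\<forall>a\<in>acar A. \<forall>b\<in>acar A. ameet A a b \<in> acar A \<and> ajoin A a b \<in> acar A) \<and>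
     (\<forall>a\<in>acar A. \<forall>b\<in>acar A. ameet A a b = ameet A b a \<and> ajoin A a b = ajoin A b a) \<and>
     (\<forall>a\<in>acar A. \<forall>b\<in>acar A. \<forall>c\<in>acar A.
        ameet A a (ameet A b c) = ameet A (ameet A a b) c \<and>
        ajoin A a (ajoin A b c) = ajoin A (ajoin A a b) c) \<and>
     (\<forall>a\<in>acar A. \<forall>b\<in>acar A.
        ameet A a (ajoin A a b) = a \<and> ajoin A a (ameet A a b) = a) \<and>
     (\<forall>a\<in>acar A. \<forall>b\<in>acar A. \<forall>c\<in>acar A.
        ameet A a (ajoin A b c) = ajoin A (ameet A a b) (ameet A a c)) \<and>
     (\<forall>a\<in>acar A. ameet A a (azero A) = azero A \<and> ameet A a (aone A) = a)"

definition WH_algebra :: "'a alg_sig \<Rightarrow> bool" where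
  "WH_algebra A \<longleftrightarrow> bdl A \<and>
     (\<forall>a\<in>acar A. \<forall>b\<in>acar A. aimp A a b \<in> acar A) \<and>
     (\<forall>a\<in>acar A. aimp A a a = aone A) \<and>
     (\<forall>a\<in>acar A. \<forall>b\<in>acar A. \<forall>c\<in>acar A.
        aimp A a (ameet A b c) = ameet A (aimp A a b) (aimp A a c) \<and>
        aimp A (ajoin A a b) c = ameet A (aimp A a c) (aimp A b c) \<and>
        alg_le A (ameet A (aimp A a b) (aimp A b c)) (aimp A a c))"

definition WD_algebra :: "'a alg_sig \<Rightarrow> bool" where
  "WD_algebra A \<longleftrightarrow> bdl A \<and>
     (\<forall>a\<in>acar A. \<forall>b\<in>acar A. acoimp A a b \<in> acar A) \<and>
     (\<forall>a\<in>acar A. acoimp A a a = azero A) \<and>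
     (\<forall>a\<in>acar A. \<forall>b\<in>acar A. \<forall>c\<in>acar A.
        acoimp A (ajoin A a b) c = ajoin A (acoimp A a c) (acoimp A b c) \<and>
        acoimp A a (ameet A b c) = ajoin A (acoimp A a b) (acoimp A a c) \<and>
        alg_le A (acoimp A a c) (ajoin A (acoimp A a b) (acoimp A b c)))"

definition WHB_algebra :: "'a alg_sig \<Rightarrow> bool" where
  "WHB_algebra A \<longleftrightarrow> WH_algebra A \<and> WD_algebra A \<and>
     (\<forall>a\<in>acar A. \<forall>b\<in>acar A.
        alg_le A (ameet A a (acoimp A (aimp A a b) (azero A))) b \<and>
        alg_le A a (ajoin A b (aimp A (aone A) (acoimp A a b))))"

definition alg_hom :: "('a \<Rightarrow> 'b) \<Rightarrow> 'a alg_sig \<Rightarrow> 'b alg_sig \<Rightarrow> bool" where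
  "alg_hom h A B \<longleftrightarrow>
     (\<forall>a\<in>acar A. h a \<in> acar B) \<and>
     (\<forall>a\<in>acar A. \<forall>b\<in>acar A.
        h (ameet A a b) = ameet B (h a) (h b) \<and>
        h (ajoin A a b) = ajoin B (h a) (h b) \<and>
        h (aimp A a b) = aimp B (h a) (h b) \<and>
        h (acoimp A a b) = acoimp B (h a) (h b)) \<and>
     h (azero A) = azero B \<and> h (aone A) = aone B"

definition alg_iso :: "('a \<Rightarrow> 'b) \<Rightarrow> 'a alg_sig \<Rightarrow> 'b alg_sig \<Rightarrow> bool" where
  "alg_iso h A B \<longleftrightarrow> alg_hom h A B \<and>
     (\<exists>g. alg_hom g B A \<and> (\<forall>a\<in>acar A. g (h a) = a) \<and> (\<forall>b\<in>acar B. h (g b) = b))"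

record 'x space_sig =
  stop :: "'x topology"
  sle  :: "'x \<Rightarrow> 'x \<Rightarrow> bool"
  sR   :: "('x \<times> 'x) set"
  sS   :: "('x \<times> 'x) set"

abbreviation pts :: "('x, 'm) space_sig_scheme \<Rightarrow> 'x set" where
  "pts X \<equiv> topspace (stop X)"

definition rimg :: "('x \<times> 'x) set \<Rightarrow> 'x \<Rightarrow> 'x set" where
  "rimg \<R> x = {y. (x, y) \<in> \<R>}"

definition rpre :: "('x \<times> 'x) set \<Rightarrow> 'x set \<Rightarrow> 'x set" where
  "rpre \<R> U = {x. rimg \<R> x \<inter> U \<noteq> {}}"

definition clopen_in :: "'x topology \<Rightarrow> 'x set \<Rightarrow> bool" where
  "clopen_in T U \<longleftrightarrow> openin T U \<and> closedin T U"

definition is_upset :: "'x space_sig \<Rightarrow> 'x set \<Rightarrow> bool" where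
  "is_upset X U \<longleftrightarrow> U \<subseteq> pts X \<and> (\<forall>x\<in>U. \<forall>y\<in>pts X. sle X x y \<longrightarrow> y \<in> U)"

definition priestley_space :: "'x space_sig \<Rightarrow> bool" where
  "priestley_space X \<longleftrightarrow>
     compact_space (stop X) \<and>
     (\<forall>x\<in>pts X. sle X x x) \<and>
     (\<forall>x\<in>pts X. \<forall>y\<in>pts X. sle X x y \<and> sle X y x \<longrightarrow> x = y) \<and>
     (\<forall>x\<in>pts X. \<forall>y\<in>pts X. \<forall>z\<in>pts X. sle X x y \<and> sle X y z \<longrightarrow> sle X x z) \<and>
     (\<forall>x\<in>pts X. \<forall>y\<in>pts X. \<not> sle X x y \<longrightarrow>
        (\<exists>U. clopen_in (stop X) U \<and> is_upset X U \<and> x \<in> U \<and> y \<notin> U))"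

definition WHB_frame :: "'x space_sig \<Rightarrow> bool" where
  "WHB_frame X \<longleftrightarrow>
     sR X \<subseteq> pts X \<times> pts X \<and> sS X \<subseteq> pts X \<times> pts X \<and>
     (\<forall>x\<in>pts X. \<forall>y\<in>pts X. \<forall>z\<in>pts X. sle X x y \<and> (y, z) \<in> sR X \<longrightarrow> (x, z) \<in> sR X) \<and>
     (\<forall>x\<in>pts X. \<forall>y\<in>pts X. \<forall>z\<in>pts X. sle X x y \<and> (x, z) \<in> sS X \<longrightarrow> (y, z) \<in> sS X) \<and>
     sS X = converse (sR X)"

definition WHB_space :: "'x space_sig \<Rightarrow> bool" where
  "WHB_space X \<longleftrightarrow> priestley_space X \<and> WHB_frame X \<and>
     (\<forall>x\<in>pts X. closedin (stop X) (rimg (sR X) x) \<and> closedin (stop X) (rimg (sS X) x)) \<and>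
     (\<forall>U. clopen_in (stop X) U \<longrightarrow>
        clopen_in (stop X) (rpre (sR X) U) \<and> clopen_in (stop X) (rpre (sS X) U))"

definition WHBS_morphism :: "('x \<Rightarrow> 'y) \<Rightarrow> 'x space_sig \<Rightarrow> 'y space_sig \<Rightarrow> bool" where
  "WHBS_morphism f X Y \<longleftrightarrow>
     continuous_map (stop X) (stop Y) f \<and>
     (\<forall>x\<in>pts X. \<forall>y\<in>pts X. sle X x y \<longrightarrow> sle Y (f x) (f y)) \<and>
     (\<forall>(\<R>1, \<R>2) \<in> {(sR X, sR Y), (sS X, sS Y)}.
        (\<forall>x y. (x, y) \<in> \<R>1 \<longrightarrow> (f x, f y) \<in> \<R>2) \<and>
        (\<forall>x\<in>pts X. \<forall>z. (f x, z) \<in> \<R>2 \<longrightarrow> (\<exists>y \<in> rimg \<R>1 x. f y = z)))"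

definition space_iso :: "('x \<Rightarrow> 'y) \<Rightarrow> 'x space_sig \<Rightarrow> 'y space_sig \<Rightarrow> bool" where
  "space_iso f X Y \<longleftrightarrow> WHBS_morphism f X Y \<and>
     (\<exists>g. WHBS_morphism g Y X \<and> (\<forall>x\<in>pts X. g (f x) = x) \<and> (\<forall>y\<in>pts Y. f (g y) = y))"

definition imp_R :: "'x space_sig \<Rightarrow> 'x set \<Rightarrow> 'x set \<Rightarrow> 'x set" where
  "imp_R X U V = {x \<in> pts X. rimg (sR X) x \<inter> U \<subseteq> V}"

definition coimp_S :: "'x space_sig \<Rightarrow> 'x set \<Rightarrow> 'x set \<Rightarrow> 'x set" where
  "coimp_S X U V = {x \<in> pts X. rimg (sS X) x \<inter> (U - V) \<noteq> {}}"

definition clopen_upsets :: "'x space_sig \<Rightarrow> 'x set set" where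
  "clopen_upsets X = {U. clopen_in (stop X) U \<and> is_upset X U}"

definition D_obj :: "'x space_sig \<Rightarrow> 'x set alg_sig" where
  "D_obj X = \<lparr> acar = clopen_upsets X, ameet = (\<inter>), ajoin = (\<union>),
     aimp = imp_R X, acoimp = coimp_S X, azero = {}, aone = pts X \<rparr>"

definition D_mor :: "'x space_sig \<Rightarrow> ('x \<Rightarrow> 'y) \<Rightarrow> 'y set \<Rightarrow> 'x set" where
  "D_mor X f U = {x \<in> pts X. f x \<in> U}"

definition prime_filter :: "'a alg_sig \<Rightarrow> 'a set \<Rightarrow> bool" where
  "prime_filter A P \<longleftrightarrow> P \<subseteq> acar A \<and>
     aone A \<in> P \<and> azero A \<notin> P \<and>
     (\<forall>a\<in>P. \<forall>b\<in>acar A. alg_le A a b \<longrightarrow> b \<in> P) \<and>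
     (\<forall>a\<in>P. \<forall>b\<in>P. ameet A a b \<in> P) \<and>
     (\<forall>a\<in>acar A. \<forall>b\<in>acar A. ajoin A a b \<in> P \<longrightarrow> a \<in> P \<or> b \<in> P)"

definition prime_filters :: "'a alg_sig \<Rightarrow> 'a set set" where
  "prime_filters A = {P. prime_filter A P}"

definition sigma :: "'a alg_sig \<Rightarrow> 'a \<Rightarrow> 'a set set" where
  "sigma A a = {P \<in> prime_filters A. a \<in> P}"

definition X_top :: "'a alg_sig \<Rightarrow> 'a set topology" where
  "X_top A = topology_generated_by
     (insert (prime_filters A)
        ((\<lambda>a. sigma A a) ` acar A \<union> (\<lambda>a. prime_filters A - sigma A a) ` acar A))"

definition X_R :: "'a alg_sig \<Rightarrow> ('a set \<times> 'a set) set" where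
  "X_R A = {(P, Q). P \<in> prime_filters A \<and> Q \<in> prime_filters A \<and>
     (\<forall>a\<in>acar A. \<forall>b\<in>acar A. aimp A a b \<in> P \<and> a \<in> Q \<longrightarrow> b \<in> Q)}"

definition X_S :: "'a alg_sig \<Rightarrow> ('a set \<times> 'a set) set" where
  "X_S A = {(P, Q). P \<in> prime_filters A \<and> Q \<in> prime_filters A \<and>
     (\<forall>a\<in>acar A. \<forall>b\<in>acar A. a \<in> Q \<and> b \<notin> Q \<longrightarrow> acoimp A a b \<in> P)}"

definition X_obj :: "'a alg_sig \<Rightarrow> 'a set space_sig" where
  "X_obj A = \<lparr> stop = X_top A, sle = (\<subseteq>), sR = X_R A, sS = X_S A \<rparr>"

definition X_mor :: "'a alg_sig \<Rightarrow> ('a \<Rightarrow> 'b) \<Rightarrow> 'b set \<Rightarrow> 'a set" where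
  "X_mor A h P = {a \<in> acar A. h a \<in> P}"

definition epsilon :: "'x space_sig \<Rightarrow> 'x \<Rightarrow> 'x set set" where
  "epsilon X x = {U \<in> clopen_upsets X. x \<in> U}"

end

theory Submission
  imports Defs
begin

text \<open>
  Everything rests on one separation lemma. Call a relation \<open>E\<close> on a bounded distributive lattice an
  entailment if it contains the order, is transitive, and respects joins on the left and meets on
  the right. A meet-closed set, none of whose members entails a member of a given join-closed set,
  extends to an \<open>E\<close>-closed prime filter disjoint from the latter. For fixed prime \<open>P\<close> the axioms of WH-
  and WD-algebras make \<open>a \<rightarrow> b \<in> P\<close> and \<open>a \<leftarrow> b \<notin> P\<close> entailments, and \<open>E\<close>-closed
  prime filters are then exactly the \<open>R\<close>- and \<open>S\<close>-successors of \<open>P\<close>. So the lemma supplies the successors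
  needed for \<open>\<sigma>\<close> to preserve \<open>\<rightarrow>\<close> and \<open>\<leftarrow>\<close> and for the back conditions of \<open>X(h)\<close>; applied to finite
  coverability it gives compactness of the space of prime filters.
\<close>

section \<open>Bounded distributive lattices and separation by prime filters\<close>

text \<open>On the algebra side, E1 and E2 are the only link between the two implications, and they
  enter in one place: they make \<open>X_S\<close> the converse of \<open>X_R\<close>. As
  \<open>S\<close> is the converse of \<open>R\<close> in every frame, comparing a space with its
  bidual comes down to comparing \<open>R\<close>. Separation supplies points; the opposite task is
  to replace infinitely many elements by one. Each time this is compactness applied to a family
  closed under binary unions, so that a finite subcover collapses to a single member. It shows that
  every clopen upset of prime filters is some \<open>sigma A a\<close>, that every prime filter of
  clopen upsets comes from a point, and that \<open>epsilon\<close> reflects \<open>R\<close>. The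
  covering sets in the last two cases are \<open>(pts X - U) \<union> V\<close> with clopen upsets
  \<open>U\<close> and \<open>V\<close>. Two upsets are needed because distinct points may be
  separated by the order in only one of the two directions.\<close>

locale bounded_distrib_lattice =
  fixes A :: "'a alg_sig"
  assumes bdl: "bdl A"
begin

abbreviation le (infix "\<sqsubseteq>" 50) where "a \<sqsubseteq> b \<equiv> alg_le A a b"
abbreviation meet (infixl "\<sqinter>" 70) where "a \<sqinter> b \<equiv> ameet A a b"
abbreviation join (infixl "\<squnion>" 65) where "a \<squnion> b \<equiv> ajoin A a b"
abbreviation carrier ("L") where "L \<equiv> acar A"

lemma zero_closed [simp]: "azero A \<in> L" and one_closed [simp]: "aone A \<in> L"
  using bdl by (auto simp: bdl_def)

lemma meet_closed [simp]: "a \<in> L \<Longrightarrow> b \<in> L \<Longrightarrow> a \<sqinter> b \<in> L"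
  and join_closed [simp]: "a \<in> L \<Longrightarrow> b \<in> L \<Longrightarrow> a \<squnion> b \<in> L"
  using bdl by (auto simp: bdl_def)

lemma meet_comm: "a \<in> L \<Longrightarrow> b \<in> L \<Longrightarrow> a \<sqinter> b = b \<sqinter> a"
  and join_comm: "a \<in> L \<Longrightarrow> b \<in> L \<Longrightarrow> a \<squnion> b = b \<squnion> a"
  using bdl by (auto simp: bdl_def)

lemma meet_assoc: "a \<in> L \<Longrightarrow> b \<in> L \<Longrightarrow> c \<in> L \<Longrightarrow> a \<sqinter> (b \<sqinter> c) = a \<sqinter> b \<sqinter> c"
  using bdl unfolding bdl_def by blast

lemma meet_join_absorb: "a \<in> L \<Longrightarrow> b \<in> L \<Longrightarrow> a \<sqinter> (a \<squnion> b) = a"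
  and join_meet_absorb: "a \<in> L \<Longrightarrow> b \<in> L \<Longrightarrow> a \<squnion> (a \<sqinter> b) = a"
  using bdl by (auto simp: bdl_def)

lemma meet_join_distrib:
  "a \<in> L \<Longrightarrow> b \<in> L \<Longrightarrow> c \<in> L \<Longrightarrow> a \<sqinter> (b \<squnion> c) = (a \<sqinter> b) \<squnion> (a \<sqinter> c)"
  using bdl by (auto simp: bdl_def)

lemma meet_idem: "a \<in> L \<Longrightarrow> a \<sqinter> a = a"
  by (metis join_meet_absorb meet_closed meet_join_absorb)

lemma le_refl [simp]: "a \<in> L \<Longrightarrow> a \<sqsubseteq> a"
  by (simp add: alg_le_def meet_idem)

lemma le_trans: "a \<sqsubseteq> b \<Longrightarrow> b \<sqsubseteq> c \<Longrightarrow> a \<in> L \<Longrightarrow> b \<in> L \<Longrightarrow> c \<in> L \<Longrightarrow> a \<sqsubseteq> c"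
  unfolding alg_le_def using meet_assoc[of a b c] by argo

lemma le_antisym: "a \<sqsubseteq> b \<Longrightarrow> b \<sqsubseteq> a \<Longrightarrow> a \<in> L \<Longrightarrow> b \<in> L \<Longrightarrow> a = b"
  using meet_comm[of a b] by (simp add: alg_le_def)

lemma le_one [simp]: "a \<in> L \<Longrightarrow> a \<sqsubseteq> aone A"
  and zero_le [simp]: "a \<in> L \<Longrightarrow> azero A \<sqsubseteq> a"
  using bdl meet_comm[of a "azero A"] by (auto simp: bdl_def alg_le_def)

lemma meet_le1 [simp]: "a \<in> L \<Longrightarrow> b \<in> L \<Longrightarrow> a \<sqinter> b \<sqsubseteq> a"
  unfolding alg_le_def
  by (simp add: meet_comm[of "a \<sqinter> b"] meet_assoc meet_idem)

lemma meet_le2 [simp]: "a \<in> L \<Longrightarrow> b \<in> L \<Longrightarrow> a \<sqinter> b \<sqsubseteq> b"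
  using meet_le1[of b a] by (simp add: meet_comm)

lemma le_join1 [simp]: "a \<in> L \<Longrightarrow> b \<in> L \<Longrightarrow> a \<sqsubseteq> a \<squnion> b"
  by (simp add: alg_le_def meet_join_absorb)

lemma le_join2 [simp]: "a \<in> L \<Longrightarrow> b \<in> L \<Longrightarrow> b \<sqsubseteq> a \<squnion> b"
  using le_join1[of b a] by (simp add: join_comm)

lemma le_meet: "a \<sqsubseteq> b \<Longrightarrow> a \<sqsubseteq> c \<Longrightarrow> a \<in> L \<Longrightarrow> b \<in> L \<Longrightarrow> c \<in> L \<Longrightarrow> a \<sqsubseteq> b \<sqinter> c"
  by (simp add: alg_le_def meet_assoc)

lemma meet_mono:
  assumes "a \<sqsubseteq> c" "b \<sqsubseteq> d" "a \<in> L" "b \<in> L" "c \<in> L" "d \<in> L"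
  shows "a \<sqinter> b \<sqsubseteq> c \<sqinter> d"
proof (rule le_meet)
  show "a \<sqinter> b \<sqsubseteq> c" using assms le_trans[of "a \<sqinter> b" a c] by simp
  show "a \<sqinter> b \<sqsubseteq> d" using assms le_trans[of "a \<sqinter> b" b d] by simp
qed (use assms in auto)

lemma join_le: "a \<sqsubseteq> c \<Longrightarrow> b \<sqsubseteq> c \<Longrightarrow> a \<in> L \<Longrightarrow> b \<in> L \<Longrightarrow> c \<in> L \<Longrightarrow> a \<squnion> b \<sqsubseteq> c"
  using meet_comm[of "a \<squnion> b" c] meet_comm[of a c] meet_comm[of b c]
  by (simp add: alg_le_def meet_join_distrib)

lemma le_iff_join: "a \<in> L \<Longrightarrow> b \<in> L \<Longrightarrow> a \<sqsubseteq> b \<longleftrightarrow> a \<squnion> b = b"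
  unfolding alg_le_def
  using join_meet_absorb[of b a] join_comm[of a b] meet_comm[of a b] meet_join_absorb[of a b] by auto

end

section \<open>Entailment relations and the prime filters closed under them\<close>

locale entailment = bounded_distrib_lattice A for A :: "'a alg_sig" +
  fixes E :: "'a \<Rightarrow> 'a \<Rightarrow> bool"
  assumes ent_le: "a \<in> L \<Longrightarrow> b \<in> L \<Longrightarrow> a \<sqsubseteq> b \<Longrightarrow> E a b"
    and ent_trans: "a \<in> L \<Longrightarrow> b \<in> L \<Longrightarrow> c \<in> L \<Longrightarrow> E a b \<Longrightarrow> E b c \<Longrightarrow> E a c"
    and ent_join: "a \<in> L \<Longrightarrow> b \<in> L \<Longrightarrow> c \<in> L \<Longrightarrow> E a c \<Longrightarrow> E b c \<Longrightarrow> E (a \<squnion> b) c"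
    and ent_meet: "a \<in> L \<Longrightarrow> b \<in> L \<Longrightarrow> c \<in> L \<Longrightarrow> E a b \<Longrightarrow> E a c \<Longrightarrow> E a (b \<sqinter> c)"
begin

text \<open>A single step of \<open>E\<close> is enough: \<open>E\<close> is transitive, and the
  sets \<open>H\<close> to which this is applied are closed under meets.\<close>

definition consequences :: "'a set \<Rightarrow> 'a set" where
  "consequences H = {b \<in> L. \<exists>a\<in>H. E a b}"

definition theory_filter :: "'a set \<Rightarrow> bool" where
  "theory_filter G \<longleftrightarrow> G \<subseteq> L \<and> (\<forall>a\<in>G. \<forall>b\<in>G. a \<sqinter> b \<in> G) \<and>
     (\<forall>a\<in>G. \<forall>b\<in>L. E a b \<longrightarrow> b \<in> G)"

lemma subset_consequences: "H \<subseteq> L \<Longrightarrow> H \<subseteq> consequences H"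
  unfolding consequences_def using ent_le le_refl by blast

text \<open>Derivations from \<open>a\<close> and from \<open>c\<close> both weaken to derivations
  from \<open>a \<sqinter> c\<close>, where \<open>ent_meet\<close> combines them.\<close>

lemma theory_filter_consequences:
  assumes H: "H \<subseteq> L" "\<And>a b. a \<in> H \<Longrightarrow> b \<in> H \<Longrightarrow> a \<sqinter> b \<in> H"
  shows "theory_filter (consequences H)"
  unfolding theory_filter_def
proof (intro conjI ballI impI)
  fix b d assume "b \<in> consequences H" "d \<in> consequences H"
  then obtain a c where *: "a \<in> H" "c \<in> H" "E a b" "E c d" "b \<in> L" "d \<in> L"
    by (auto simp: consequences_def)
  then have L: "a \<in> L" "c \<in> L" using H by auto
  have "E (a \<sqinter> c) b" "E (a \<sqinter> c) d"
    using * L ent_trans[of "a \<sqinter> c" a b] ent_trans[of "a \<sqinter> c" c d] by (simp_all add: ent_le)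
  then have "E (a \<sqinter> c) (b \<sqinter> d)" using * L by (simp add: ent_meet)
  moreover have "a \<sqinter> c \<in> H" using * H by blast
  ultimately show "b \<sqinter> d \<in> consequences H" using * unfolding consequences_def by auto
next
  fix b c assume *: "b \<in> consequences H" "c \<in> L" "E b c"
  then obtain a where a: "a \<in> H" "E a b" "b \<in> L" by (auto simp: consequences_def)
  then have "E a c" using * H by (meson ent_trans subsetD)
  then show "c \<in> consequences H" using * a unfolding consequences_def by auto
qed (auto simp: consequences_def)

text \<open>A maximal \<open>E\<close>-closed filter disjoint from an ideal is prime because the disjunction rule
  \<open>ent_join\<close> lets one merge the two derivations that arise from adjoining \<open>a\<close> or \<open>b\<close>.\<close>

lemma prime_filter_separation:
  assumes F: "F \<subseteq> L" "F \<noteq> {}" "\<And>a b. a \<in> F \<Longrightarrow> b \<in> F \<Longrightarrow> a \<sqinter> b \<in> F"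
    and I: "I \<subseteq> L" "I \<noteq> {}" "\<And>a b. a \<in> I \<Longrightarrow> b \<in> I \<Longrightarrow> a \<squnion> b \<in> I"
    and sep: "\<And>a b. a \<in> F \<Longrightarrow> b \<in> I \<Longrightarrow> \<not> E a b"
  obtains Q where "prime_filter A Q" "F \<subseteq> Q" "Q \<inter> I = {}"
    "\<And>a b. a \<in> Q \<Longrightarrow> b \<in> L \<Longrightarrow> E a b \<Longrightarrow> b \<in> Q"
proof -
  define \<G> where "\<G> = {G. theory_filter G \<and> F \<subseteq> G \<and> G \<inter> I = {}}"
  have "consequences F \<in> \<G>"
    using F sep theory_filter_consequences subset_consequences
    by (auto simp: \<G>_def consequences_def)
  moreover have "\<Union>\<C> \<in> \<G>" if "\<C> \<noteq> {}" "subset.chain \<G> \<C>" for \<C>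
  proof -
    have mem: "\<And>G. G \<in> \<C> \<Longrightarrow> theory_filter G \<and> F \<subseteq> G \<and> G \<inter> I = {}"
      and chain: "\<And>G H. G \<in> \<C> \<Longrightarrow> H \<in> \<C> \<Longrightarrow> G \<subseteq> H \<or> H \<subseteq> G"
      using that(2) by (auto simp: subset_chain_def \<G>_def)
    have "a \<sqinter> b \<in> \<Union>\<C>" if ab: "a \<in> \<Union>\<C>" "b \<in> \<Union>\<C>" for a b
    proof -
      obtain G H where "G \<in> \<C>" "H \<in> \<C>" "a \<in> G" "b \<in> H" using ab by blast
      then obtain K where K: "K \<in> \<C>" "a \<in> K" "b \<in> K" using chain by blast
      then have "a \<sqinter> b \<in> K" using mem[of K] unfolding theory_filter_def by blast
      then show ?thesis using K by blast
    qed
    moreover have "b \<in> \<Union>\<C>" if "a \<in> \<Union>\<C>" "b \<in> L" "E a b" for a b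
      using that mem unfolding theory_filter_def by (meson UnionE UnionI)
    moreover have "\<Union>\<C> \<subseteq> L" "F \<subseteq> \<Union>\<C>" "\<Union>\<C> \<inter> I = {}"
      using mem \<open>\<C> \<noteq> {}\<close> unfolding theory_filter_def by blast+
    ultimately show ?thesis unfolding \<G>_def theory_filter_def by blast
  qed
  ultimately obtain Q where Q: "Q \<in> \<G>" and max: "\<And>G. G \<in> \<G> \<Longrightarrow> Q \<subseteq> G \<Longrightarrow> G = Q"
    using subset_Zorn_nonempty[of \<G>] by (metis empty_iff)
  have QL: "Q \<subseteq> L" and Q_meet: "\<And>a b. a \<in> Q \<Longrightarrow> b \<in> Q \<Longrightarrow> a \<sqinter> b \<in> Q"
    and Q_up: "\<And>a b. a \<in> Q \<Longrightarrow> b \<in> L \<Longrightarrow> E a b \<Longrightarrow> b \<in> Q" and FQ: "F \<subseteq> Q" and QI: "Q \<inter> I = {}"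
    using Q by (auto simp: \<G>_def theory_filter_def)
  obtain f i where f: "f \<in> F" and i: "i \<in> I" using F I by blast
  \<comment> \<open>By maximality, adjoining \<open>a\<close> to \<open>Q\<close> must produce an
    element of \<open>I\<close>: otherwise the consequences of the elements
    \<open>q \<sqinter> a\<close> would form a strictly larger member of
    \<open>\<G>\<close>.\<close>
  have adjoin: "\<exists>q\<in>Q. \<exists>j\<in>I. E (q \<sqinter> a) j" if a: "a \<in> L" "a \<notin> Q" for a
  proof (rule ccontr)
    assume none: "\<not> ?thesis"
    define H where "H = (\<lambda>q. q \<sqinter> a) ` Q"
    have HL: "H \<subseteq> L" using QL a by (auto simp: H_def)
    have "(q \<sqinter> a) \<sqinter> (r \<sqinter> a) = (q \<sqinter> r) \<sqinter> a" if "q \<in> Q" "r \<in> Q" for q r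
    proof -
      have L: "q \<in> L" "r \<in> L" using that QL by auto
      then have "(q \<sqinter> a) \<sqinter> (r \<sqinter> a) = q \<sqinter> (a \<sqinter> (r \<sqinter> a))"
        using a by (simp add: meet_assoc)
      also have "a \<sqinter> (r \<sqinter> a) = r \<sqinter> a"
        using L a by (metis alg_le_def meet_closed meet_comm meet_le2)
      finally show ?thesis using L a by (simp add: meet_assoc)
    qed
    then have "theory_filter (consequences H)"
      using Q_meet HL by (intro theory_filter_consequences) (auto simp: H_def)
    moreover have QH: "Q \<subseteq> consequences H"
      unfolding consequences_def H_def using QL a ent_le meet_le1 meet_closed by blast
    ultimately have "consequences H \<in> \<G>"
      using none FQ by (auto simp: \<G>_def consequences_def H_def)
    then have "consequences H = Q" using max QH by blast
    moreover have "a \<in> consequences H"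
      unfolding consequences_def H_def using a QL FQ f ent_le meet_le2 meet_closed by blast
    ultimately show False using a by simp
  qed
  have "prime_filter A Q"
    unfolding prime_filter_def
  proof (intro conjI ballI impI)
    show "aone A \<in> Q" using f FQ QL Q_up ent_le le_one one_closed by blast
    show "azero A \<notin> Q" using i I QI Q_up ent_le zero_le zero_closed by blast
    show "b \<in> Q" if "a \<in> Q" "b \<in> L" "a \<sqsubseteq> b" for a b
      using that QL Q_up ent_le by blast
  next
    fix a b assume a: "a \<in> L" and b: "b \<in> L" and ab: "a \<squnion> b \<in> Q"
    show "a \<in> Q \<or> b \<in> Q"
    proof (rule ccontr)
      assume "\<not> ?thesis"
      then obtain q r j k where *: "q \<in> Q" "r \<in> Q" "j \<in> I" "k \<in> I" "E (q \<sqinter> a) j" "E (r \<sqinter> b) k"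
        using adjoin a b by metis
      \<comment> \<open>\<open>s\<close> strengthens both premises and \<open>m\<close> weakens both
        conclusions, so that the two derivations have the common shape that \<open>ent_join\<close>
        requires.\<close>
      define s m where "s = q \<sqinter> r" and "m = j \<squnion> k"
      have qrjk: "q \<in> L" "r \<in> L" "j \<in> L" "k \<in> L" using * QL I(1) by auto
      then have L: "q \<in> L" "r \<in> L" "j \<in> L" "k \<in> L" "s \<in> L" "m \<in> L"
        by (auto simp: s_def m_def)
      have "s \<sqinter> a \<sqsubseteq> q \<sqinter> a" "s \<sqinter> b \<sqsubseteq> r \<sqinter> b"
        unfolding s_def using L a b by (auto intro: meet_mono)
      moreover have "j \<sqsubseteq> m" "k \<sqsubseteq> m" using L by (auto simp: m_def)
      ultimately have "E (s \<sqinter> a) m" "E (s \<sqinter> b) m"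
        using * L a b ent_trans[of "s \<sqinter> a" "q \<sqinter> a" m] ent_trans[of "q \<sqinter> a" j m]
          ent_trans[of "s \<sqinter> b" "r \<sqinter> b" m] ent_trans[of "r \<sqinter> b" k m]
        by (simp_all add: ent_le)
      then have "E (s \<sqinter> (a \<squnion> b)) m"
        using L a b by (simp add: meet_join_distrib ent_join)
      moreover have "s \<sqinter> (a \<squnion> b) \<in> Q" using * ab Q_meet by (simp add: s_def)
      ultimately have "m \<in> Q" using Q_up L by blast
      then show False using I QI * by (auto simp: m_def)
    qed
  qed (use QL Q_meet in auto)
  then show thesis using FQ QI Q_up by (rule that)
qed

text \<open>Singletons serve as \<open>F\<close> and \<open>I\<close>, since only closure under
  meets and joins is asked of them and both operations are idempotent.\<close>

lemma prime_filter_separation_point: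
  assumes "a \<in> L" "b \<in> L" "\<not> E a b"
  obtains Q where "prime_filter A Q" "a \<in> Q" "b \<notin> Q"
    "\<And>c d. c \<in> Q \<Longrightarrow> d \<in> L \<Longrightarrow> E c d \<Longrightarrow> d \<in> Q"
proof -
  have "b \<squnion> b = b" using assms le_iff_join[of b b] by simp
  moreover have "a \<sqinter> a = a" using assms(1) by (rule meet_idem)
  ultimately obtain Q where "prime_filter A Q" "{a} \<subseteq> Q" "Q \<inter> {b} = {}"
    and "\<And>c d. c \<in> Q \<Longrightarrow> d \<in> L \<Longrightarrow> E c d \<Longrightarrow> d \<in> Q"
    using assms by (elim prime_filter_separation[of "{a}" "{b}", rotated -1]) auto
  then show thesis using that[of Q] by simp
qed

end

section \<open>The Priestley space of prime filters\<close>

text \<open>The form in which compactness is used later: a finite subcover of a family closed under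
  binary unions can be merged into one member. Nonemptiness of \<open>\<U>\<close> handles the empty
  subcover.\<close>

lemma directed_cover:
  assumes "compactin T K" "\<U> \<noteq> {}" and "\<And>U. U \<in> \<U> \<Longrightarrow> openin T U"
    and Un: "\<And>U V. U \<in> \<U> \<Longrightarrow> V \<in> \<U> \<Longrightarrow> U \<union> V \<in> \<U>" and "K \<subseteq> \<Union>\<U>"
  obtains U where "U \<in> \<U>" "K \<subseteq> U"
proof -
  obtain \<F> where F: "finite \<F>" "\<F> \<subseteq> \<U>" "K \<subseteq> \<Union>\<F>"
    using assms unfolding compactin_def by meson
  have "\<Union>\<F> \<in> \<U>" if "\<F> \<noteq> {}"
    using F(1) that F(2) by (induction rule: finite_ne_induct) (auto intro: Un)
  then show thesis
    using that F \<open>\<U> \<noteq> {}\<close> by (cases "\<F> = {}") auto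
qed

lemma clopen_in_empty [simp]: "clopen_in T {}"
  and clopen_in_topspace [simp]: "clopen_in T (topspace T)"
  by (simp_all add: clopen_in_def)

lemma clopen_in_Un: "clopen_in T U \<Longrightarrow> clopen_in T V \<Longrightarrow> clopen_in T (U \<union> V)"
  and clopen_in_Int: "clopen_in T U \<Longrightarrow> clopen_in T V \<Longrightarrow> clopen_in T (U \<inter> V)"
  and clopen_in_diff: "clopen_in T U \<Longrightarrow> clopen_in T V \<Longrightarrow> clopen_in T (U - V)"
  by (auto simp: clopen_in_def)

lemma rpre_Un: "rpre \<R> (U \<union> V) = rpre \<R> U \<union> rpre \<R> V"
  by (auto simp: rpre_def)

lemma topspace_X_top [simp]: "topspace (X_top A) = prime_filters A"
  by (auto simp: X_top_def sigma_def)

lemma X_obj_simps [simp]: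
  "stop (X_obj A) = X_top A" "sle (X_obj A) P Q \<longleftrightarrow> P \<subseteq> Q"
  "sR (X_obj A) = X_R A" "sS (X_obj A) = X_S A"
  by (simp_all add: X_obj_def)

lemma sigma_subset: "sigma A a \<subseteq> prime_filters A"
  by (auto simp: sigma_def)

lemma prime_filtersD:
  assumes "P \<in> prime_filters A"
  shows "P \<subseteq> acar A" "aone A \<in> P" "azero A \<notin> P"
    and "\<And>a b. a \<in> P \<Longrightarrow> b \<in> acar A \<Longrightarrow> alg_le A a b \<Longrightarrow> b \<in> P"
    and "\<And>a b. a \<in> P \<Longrightarrow> b \<in> P \<Longrightarrow> ameet A a b \<in> P"
    and "\<And>a b. a \<in> acar A \<Longrightarrow> b \<in> acar A \<Longrightarrow> ajoin A a b \<in> P \<Longrightarrow> a \<in> P \<or> b \<in> P"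
  using assms unfolding prime_filters_def prime_filter_def by blast+

lemma openin_sigma: "a \<in> acar A \<Longrightarrow> openin (X_top A) (sigma A a)"
  and openin_compl_sigma: "a \<in> acar A \<Longrightarrow> openin (X_top A) (prime_filters A - sigma A a)"
  unfolding X_top_def by (auto intro!: topology_generated_by_Basis)

lemma clopen_sigma: "a \<in> acar A \<Longrightarrow> clopen_in (X_top A) (sigma A a)"
  using openin_sigma openin_compl_sigma by (auto simp: clopen_in_def closedin_def sigma_def)

section \<open>Basic, closed and clopen sets of prime filters\<close>

context bounded_distrib_lattice
begin

lemma prime_filter_meet_iff:
  assumes "P \<in> prime_filters A" "a \<in> L" "b \<in> L"
  shows "a \<sqinter> b \<in> P \<longleftrightarrow> a \<in> P \<and> b \<in> P"
  using prime_filtersD(4)[OF assms(1) _ assms(2), of "a \<sqinter> b"] prime_filtersD(5)[OF assms(1)]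
    prime_filtersD(4)[OF assms(1) _ assms(3), of "a \<sqinter> b"] meet_le1[OF assms(2,3)]
    meet_le2[OF assms(2,3)] by blast

lemma prime_filter_join_iff:
  assumes "P \<in> prime_filters A" "a \<in> L" "b \<in> L"
  shows "a \<squnion> b \<in> P \<longleftrightarrow> a \<in> P \<or> b \<in> P"
  using prime_filtersD(4)[OF assms(1), of _ "a \<squnion> b"] prime_filtersD(6)[OF assms]
    join_closed[OF assms(2,3)] le_join1[OF assms(2,3)] le_join2[OF assms(2,3)] by blast

lemma sigma_meet: "a \<in> L \<Longrightarrow> b \<in> L \<Longrightarrow> sigma A (a \<sqinter> b) = sigma A a \<inter> sigma A b"
  and sigma_join: "a \<in> L \<Longrightarrow> b \<in> L \<Longrightarrow> sigma A (a \<squnion> b) = sigma A a \<union> sigma A b"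
  by (auto simp: sigma_def prime_filter_meet_iff prime_filter_join_iff)

lemma sigma_one: "sigma A (aone A) = prime_filters A"
  and sigma_zero: "sigma A (azero A) = {}"
  by (auto simp: sigma_def prime_filtersD)

lemma entailment_le: "entailment A (alg_le A)"
  by unfold_locales (auto intro: le_trans join_le le_meet)

text \<open>The prime filter theorem for distributive lattices, obtained as separation for the order
  itself as entailment. It makes \<open>sigma\<close> injective.\<close>

lemma sigma_subset_iff:
  assumes "a \<in> L" "b \<in> L"
  shows "sigma A a \<subseteq> sigma A b \<longleftrightarrow> a \<sqsubseteq> b"
proof
  assume sub: "sigma A a \<subseteq> sigma A b"
  show "a \<sqsubseteq> b"
  proof (rule ccontr)
    assume "\<not> a \<sqsubseteq> b"
    then obtain Q where "prime_filter A Q" "a \<in> Q" "b \<notin> Q"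
      using entailment.prime_filter_separation_point[OF entailment_le] assms by metis
    then show False using sub by (auto simp: sigma_def prime_filters_def)
  qed
qed (use assms prime_filtersD(4) in \<open>auto simp: sigma_def\<close>)

text \<open>Differences \<open>sigma A a - sigma A b\<close> are closed under binary intersection
  and include every subbasic set, so induction over the generated topology stays within this one
  shape; a missing side is filled by \<open>aone A\<close> or \<open>azero A\<close>.\<close>

lemma X_top_basis:
  assumes "openin (X_top A) U" "P \<in> U"
  obtains a b where "a \<in> L" "b \<in> L" "P \<in> sigma A a - sigma A b" "sigma A a - sigma A b \<subseteq> U"
proof -
  have "\<exists>a\<in>L. \<exists>b\<in>L. P \<in> sigma A a - sigma A b \<and> sigma A a - sigma A b \<subseteq> U"
    using openin_topology_generated_by[OF assms(1)[unfolded X_top_def]] assms(2)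
  proof (induction)
    case (Int U V)
    then obtain a b c d where *: "a \<in> L" "b \<in> L" "c \<in> L" "d \<in> L"
      "P \<in> sigma A a - sigma A b" "sigma A a - sigma A b \<subseteq> U"
      "P \<in> sigma A c - sigma A d" "sigma A c - sigma A d \<subseteq> V" by auto
    then have "P \<in> sigma A (a \<sqinter> c) - sigma A (b \<squnion> d)"
      "sigma A (a \<sqinter> c) - sigma A (b \<squnion> d) \<subseteq> U \<inter> V"
      by (auto simp: sigma_meet sigma_join)
    moreover have "a \<sqinter> c \<in> L" "b \<squnion> d \<in> L" using * by simp_all
    ultimately show ?case by blast
  next
    case (UN \<K>)
    then obtain K where K: "K \<in> \<K>" "P \<in> K" by blast
    then obtain a b where "a \<in> L" "b \<in> L" "P \<in> sigma A a - sigma A b" "sigma A a - sigma A b \<subseteq> K"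
      using UN by blast
    then show ?case using K by blast
  next
    case (Basis U)
    then consider "U = prime_filters A" | a where "a \<in> L" "U = sigma A a"
      | a where "a \<in> L" "U = prime_filters A - sigma A a" by blast
    then show ?case
    proof cases
      case 1
      then have "U = sigma A (aone A) - sigma A (azero A)" by (simp add: sigma_one sigma_zero)
      then show ?thesis using Basis one_closed zero_closed by blast
    next
      case 2
      then have "U = sigma A a - sigma A (azero A)" by (simp add: sigma_zero)
      then show ?thesis using Basis 2 zero_closed by blast
    next
      case 3
      then have "U = sigma A (aone A) - sigma A a" by (simp add: sigma_one)
      then show ?thesis using Basis 3 one_closed by blast
    qed
  qed simp
  then show thesis using that by blast
qed

text \<open>That \<open>sigma a - sigma b\<close> has a finite subcover is an entailment relation; if it failed for
  \<open>1\<close> and \<open>0\<close>, a prime filter closed under it would be a point left uncovered.\<close>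

lemma compact_space_X_top: "compact_space (X_top A)"
  unfolding compact_space_alt
proof (intro allI impI)
  fix \<U> assume \<U>: "(\<forall>U\<in>\<U>. openin (X_top A) U) \<and> topspace (X_top A) \<subseteq> \<Union>\<U>"
  define E where "E a b \<longleftrightarrow> (\<exists>\<F>. finite \<F> \<and> \<F> \<subseteq> \<U> \<and> sigma A a - sigma A b \<subseteq> \<Union>\<F>)" for a b
  \<comment> \<open>One inclusion between differences serves three rules. Transitivity is
    \<open>sigma A a - sigma A c \<subseteq> (sigma A a - sigma A b) \<union> (sigma A b - sigma A
    c)\<close>; joins on the left and meets on the right split similarly.\<close>
  have E_Un: "E a b" if "E c d" "E e f"
    "sigma A a - sigma A b \<subseteq> (sigma A c - sigma A d) \<union> (sigma A e - sigma A f)" for a b c d e f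
  proof -
    obtain \<F> \<G> where "finite \<F>" "\<F> \<subseteq> \<U>" "sigma A c - sigma A d \<subseteq> \<Union>\<F>"
      "finite \<G>" "\<G> \<subseteq> \<U>" "sigma A e - sigma A f \<subseteq> \<Union>\<G>"
      using \<open>E c d\<close> \<open>E e f\<close> unfolding E_def by blast
    then show ?thesis
      using that(3) unfolding E_def by (intro exI[of _ "\<F> \<union> \<G>"]) auto
  qed
  interpret entailment A E
  proof
    show "E a b" if "a \<in> L" "b \<in> L" "a \<sqsubseteq> b" for a b
      using that sigma_subset_iff[of a b] unfolding E_def by (intro exI[of _ "{}"]) auto
    show "E a c" if "E a b" "E b c" for a b c
      by (rule E_Un[OF that]) auto
    show "E (a \<squnion> b) c" if "a \<in> L" "b \<in> L" "E a c" "E b c" for a b c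
      by (rule E_Un[OF that(3,4)]) (auto simp: sigma_join that)
    show "E a (b \<sqinter> c)" if "b \<in> L" "c \<in> L" "E a b" "E a c" for a b c
      by (rule E_Un[OF that(3,4)]) (auto simp: sigma_meet that)
  qed
  have "E (aone A) (azero A)"
  proof (rule ccontr)
    assume "\<not> ?thesis"
    from prime_filter_separation_point[OF one_closed zero_closed this]
    obtain Q where Q: "prime_filter A Q"
      and closed: "\<And>c d. c \<in> Q \<Longrightarrow> d \<in> L \<Longrightarrow> E c d \<Longrightarrow> d \<in> Q"
      by metis
    then obtain U where U: "U \<in> \<U>" "Q \<in> U"
      using \<U> by (auto simp: prime_filters_def)
    then obtain a b where ab: "a \<in> L" "b \<in> L" "Q \<in> sigma A a - sigma A b" "sigma A a - sigma A b \<subseteq> U"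
      using \<U> X_top_basis by metis
    then have "E a b" unfolding E_def using U by (intro exI[of _ "{U}"]) auto
    then show False using ab closed by (auto simp: sigma_def)
  qed
  then show "\<exists>\<F>. finite \<F> \<and> \<F> \<subseteq> \<U> \<and> topspace (X_top A) \<subseteq> \<Union>\<F>"
    by (simp add: E_def sigma_one sigma_zero)
qed

lemma priestley_space_X_obj: "priestley_space (X_obj A)"
  unfolding priestley_space_def
proof (intro conjI ballI impI)
  fix P Q assume *: "P \<in> pts (X_obj A)" "Q \<in> pts (X_obj A)" "\<not> sle (X_obj A) P Q"
  then obtain a where "a \<in> P" "a \<notin> Q" by auto
  with * show "\<exists>U. clopen_in (stop (X_obj A)) U \<and> is_upset (X_obj A) U \<and> P \<in> U \<and> Q \<notin> U"
    using prime_filtersD(1)[of P] clopen_sigma[of a A]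
    by (intro exI[of _ "sigma A a"]) (auto simp: is_upset_def sigma_def)
qed (use compact_space_X_top in auto)

lemma closedin_X_topI:
  assumes "C \<subseteq> prime_filters A"
    and "\<And>Q. Q \<in> prime_filters A \<Longrightarrow> Q \<notin> C \<Longrightarrow>
      \<exists>a\<in>L. \<exists>b\<in>L. Q \<in> sigma A a - sigma A b \<and> (sigma A a - sigma A b) \<inter> C = {}"
  shows "closedin (X_top A) C"
proof -
  have "openin (X_top A) (prime_filters A - C)"
  proof (subst openin_subopen, intro ballI)
    fix Q assume "Q \<in> prime_filters A - C"
    then obtain a b where "a \<in> L" "b \<in> L" "Q \<in> sigma A a - sigma A b"
      "(sigma A a - sigma A b) \<inter> C = {}" using assms(2) by blast
    then show "\<exists>T. openin (X_top A) T \<and> Q \<in> T \<and> T \<subseteq> prime_filters A - C"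
      using clopen_in_diff[OF clopen_sigma clopen_sigma, of a A b] sigma_subset[of A a]
      by (intro exI[of _ "sigma A a - sigma A b"]) (auto simp: clopen_in_def)
  qed
  then show ?thesis using assms(1) by (simp add: closedin_def)
qed

text \<open>\<open>rpre\<close> commutes with binary unions, so the open subsets of \<open>U\<close>
  with clopen preimage are closed under them. Basic sets show that they cover the compact set
  \<open>U\<close>, hence \<open>U\<close> is one of them.\<close>

lemma clopen_rpreI:
  assumes basic: "\<And>a b. a \<in> L \<Longrightarrow> b \<in> L \<Longrightarrow> clopen_in (X_top A) (rpre \<R> (sigma A a - sigma A b))"
    and U: "clopen_in (X_top A) U"
  shows "clopen_in (X_top A) (rpre \<R> U)"
proof -
  define \<V> where "\<V> = {V. V \<subseteq> U \<and> openin (X_top A) V \<and> clopen_in (X_top A) (rpre \<R> V)}"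
  have "compactin (X_top A) U"
    using U compact_space_X_top by (simp add: clopen_in_def closedin_compact_space)
  moreover have "{} \<in> \<V>" by (simp add: \<V>_def rpre_def)
  moreover have "U \<subseteq> \<Union>\<V>"
  proof
    fix P assume "P \<in> U"
    then obtain a b where *: "a \<in> L" "b \<in> L" "P \<in> sigma A a - sigma A b" "sigma A a - sigma A b \<subseteq> U"
      using U X_top_basis unfolding clopen_in_def by metis
    then have "sigma A a - sigma A b \<in> \<V>"
      using basic clopen_in_diff[OF clopen_sigma clopen_sigma, of a A b]
      by (auto simp: \<V>_def clopen_in_def)
    then show "P \<in> \<Union>\<V>" using * by blast
  qed
  moreover have "V \<union> W \<in> \<V>" if "V \<in> \<V>" "W \<in> \<V>" for V W
    using that by (auto simp: \<V>_def rpre_Un clopen_in_Un)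
  moreover have "openin (X_top A) V" if "V \<in> \<V>" for V
    using that by (simp add: \<V>_def)
  ultimately obtain V where "V \<in> \<V>" "U \<subseteq> V"
    using directed_cover[of "X_top A" U \<V>] by (metis empty_iff)
  then show ?thesis by (auto simp: \<V>_def)
qed

text \<open>This is surjectivity of \<open>sigma\<close>. Compactness is used twice: for the
  complement of \<open>U\<close>, to fit some \<open>sigma A a\<close> between a point and
  \<open>U\<close>, and for \<open>U\<close> itself, to join finitely many such elements.\<close>

lemma clopen_upset_eq_sigma:
  assumes "U \<in> clopen_upsets (X_obj A)"
  obtains a where "a \<in> L" "U = sigma A a"
proof -
  have U: "clopen_in (X_top A) U" "U \<subseteq> prime_filters A"
    and up: "\<And>P Q. P \<in> U \<Longrightarrow> Q \<in> prime_filters A \<Longrightarrow> P \<subseteq> Q \<Longrightarrow> Q \<in> U"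
    using assms by (auto simp: clopen_upsets_def is_upset_def)
  have comp: "compactin (X_top A) U" "compactin (X_top A) (prime_filters A - U)"
    using U(1) clopen_in_diff[OF clopen_in_topspace U(1)] compact_space_X_top
    by (auto simp: clopen_in_def closedin_compact_space)
  \<comment> \<open>As \<open>U\<close> is an upset, \<open>P\<close> is contained in no
    \<open>Q\<close> outside \<open>U\<close>, so some \<open>a \<in> P\<close> is missing from
    \<open>Q\<close>. Closure of \<open>P\<close> under meets makes the cover of the complement by
    such sets directed.\<close>
  have nbhd: "\<exists>a\<in>P. sigma A a \<subseteq> U" if P: "P \<in> U" for P
  proof -
    have PA: "P \<in> prime_filters A" using P U by blast
    define \<V> where "\<V> = (\<lambda>a. prime_filters A - sigma A a) ` P"
    have "V \<union> W \<in> \<V>" if VW: "V \<in> \<V>" "W \<in> \<V>" for V W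
    proof -
      obtain a b where "a \<in> P" "b \<in> P" "V = prime_filters A - sigma A a" "W = prime_filters A - sigma A b"
        using VW by (auto simp: \<V>_def)
      moreover from this have "a \<in> L" "b \<in> L" using prime_filtersD(1)[OF PA] by auto
      ultimately have "a \<sqinter> b \<in> P" "V \<union> W = prime_filters A - sigma A (a \<sqinter> b)"
        using prime_filtersD(5)[OF PA] by (auto simp: sigma_meet)
      then show ?thesis unfolding \<V>_def by (rule rev_image_eqI)
    qed
    moreover have "prime_filters A - U \<subseteq> \<Union>\<V>"
    proof
      fix Q assume Q: "Q \<in> prime_filters A - U"
      then obtain a where "a \<in> P" "a \<notin> Q" using up P by blast
      then show "Q \<in> \<Union>\<V>" using Q by (auto simp: \<V>_def sigma_def)
    qed
    moreover have "\<V> \<noteq> {}" using prime_filtersD(2)[OF PA] by (auto simp: \<V>_def)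
    moreover have "openin (X_top A) V" if "V \<in> \<V>" for V
      using that prime_filtersD(1)[OF PA] by (auto simp: \<V>_def intro!: openin_compl_sigma)
    ultimately obtain V where "V \<in> \<V>" "prime_filters A - U \<subseteq> V"
      using directed_cover[OF comp(2), of \<V>] by metis
    then show ?thesis using sigma_subset[of A] by (fastforce simp: \<V>_def)
  qed
  define \<V> where "\<V> = {sigma A a | a. a \<in> L \<and> sigma A a \<subseteq> U}"
  have "V \<union> W \<in> \<V>" if VW: "V \<in> \<V>" "W \<in> \<V>" for V W
  proof -
    obtain a b where *: "a \<in> L" "b \<in> L" "V = sigma A a" "W = sigma A b" "V \<subseteq> U" "W \<subseteq> U"
      using VW by (auto simp: \<V>_def)
    then have "V \<union> W = sigma A (a \<squnion> b)" by (simp add: sigma_join)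
    moreover have "sigma A (a \<squnion> b) \<subseteq> U" "a \<squnion> b \<in> L" using * by (simp_all add: sigma_join)
    ultimately show ?thesis unfolding \<V>_def by blast
  qed
  moreover have "U \<subseteq> \<Union>\<V>"
  proof
    fix P assume "P \<in> U"
    then obtain a where "a \<in> P" "sigma A a \<subseteq> U" using nbhd by blast
    moreover have "a \<in> L" "P \<in> sigma A a"
      using \<open>P \<in> U\<close> U(2) \<open>a \<in> P\<close> prime_filtersD(1)[of P] by (auto simp: sigma_def)
    ultimately show "P \<in> \<Union>\<V>" unfolding \<V>_def by blast
  qed
  moreover have "sigma A (azero A) \<in> \<V>"
    unfolding \<V>_def using sigma_zero by (auto intro!: exI[of _ "azero A"])
  moreover have "openin (X_top A) V" if "V \<in> \<V>" for V
    using that openin_sigma by (auto simp: \<V>_def)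
  ultimately obtain V where "V \<in> \<V>" "U \<subseteq> V"
    using directed_cover[OF comp(1), of \<V>] by (metis empty_iff)
  then show thesis using that by (auto simp: \<V>_def)
qed

end

section \<open>The dual space of a WHB-algebra\<close>

lemma WH_algebra_lattice: "WH_algebra A \<Longrightarrow> bounded_distrib_lattice A"
  and WD_algebra_lattice: "WD_algebra A \<Longrightarrow> bounded_distrib_lattice A"
  by (simp_all add: WH_algebra_def WD_algebra_def bounded_distrib_lattice_def)

lemma WHB_algebraD:
  assumes "WHB_algebra A"
  shows "WH_algebra A" "WD_algebra A" "bounded_distrib_lattice A"
  using assms WH_algebra_lattice by (auto simp: WHB_algebra_def)

lemma aimp_closed: "WH_algebra A \<Longrightarrow> a \<in> acar A \<Longrightarrow> b \<in> acar A \<Longrightarrow> aimp A a b \<in> acar A"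
  by (simp add: WH_algebra_def)

lemma acoimp_closed: "WD_algebra A \<Longrightarrow> a \<in> acar A \<Longrightarrow> b \<in> acar A \<Longrightarrow> acoimp A a b \<in> acar A"
  by (simp add: WD_algebra_def)

text \<open>Only \<open>ent_le\<close> is not an axiom read inside \<open>P\<close>: if
  \<open>a \<sqsubseteq> b\<close> then \<open>a \<sqinter> b = a\<close>, and expanding
  \<open>aimp A a (a \<sqinter> b)\<close> puts \<open>aimp A a a\<close>, which is
  \<open>aone A\<close>, below \<open>aimp A a b\<close>.\<close>

lemma entailment_aimp:
  assumes A: "WH_algebra A" and P: "P \<in> prime_filters A"
  shows "entailment A (\<lambda>a b. aimp A a b \<in> P)"
proof -
  interpret bounded_distrib_lattice A using A by (rule WH_algebra_lattice)
  note imp_closed = aimp_closed[OF A]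
  have refl: "\<And>a. a \<in> L \<Longrightarrow> aimp A a a = aone A"
    and meet: "\<And>a b c. a \<in> L \<Longrightarrow> b \<in> L \<Longrightarrow> c \<in> L \<Longrightarrow> aimp A a (b \<sqinter> c) = aimp A a b \<sqinter> aimp A a c"
    and join: "\<And>a b c. a \<in> L \<Longrightarrow> b \<in> L \<Longrightarrow> c \<in> L \<Longrightarrow> aimp A (a \<squnion> b) c = aimp A a c \<sqinter> aimp A b c"
    and trans: "\<And>a b c. a \<in> L \<Longrightarrow> b \<in> L \<Longrightarrow> c \<in> L \<Longrightarrow> aimp A a b \<sqinter> aimp A b c \<sqsubseteq> aimp A a c"
    using A unfolding WH_algebra_def by blast+
  show ?thesis
  proof
    fix a b assume ab: "a \<in> L" "b \<in> L" "a \<sqsubseteq> b"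
    have "aimp A a a \<sqinter> aimp A a b = aimp A a a"
      using ab meet[of a a b] by (simp add: alg_le_def)
    then show "aimp A a b \<in> P"
      using ab prime_filtersD(2)[OF P] prime_filter_meet_iff[OF P, of "aimp A a a" "aimp A a b"]
      by (simp add: refl imp_closed)
  next
    fix a b c assume abc: "a \<in> L" "b \<in> L" "c \<in> L" "aimp A a b \<in> P" "aimp A b c \<in> P"
    have "aimp A a b \<sqinter> aimp A b c \<in> P" by (rule prime_filtersD(5)[OF P abc(4,5)])
    then show "aimp A a c \<in> P"
      by (rule prime_filtersD(4)[OF P]) (simp_all add: imp_closed trans abc)
  next
    fix a b c assume "a \<in> L" "b \<in> L" "c \<in> L" "aimp A a c \<in> P" "aimp A b c \<in> P"
    then show "aimp A (a \<squnion> b) c \<in> P" by (simp add: join prime_filtersD(5)[OF P])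
  next
    fix a b c assume "a \<in> L" "b \<in> L" "c \<in> L" "aimp A a b \<in> P" "aimp A a c \<in> P"
    then show "aimp A a (b \<sqinter> c) \<in> P" by (simp add: meet prime_filtersD(5)[OF P])
  qed
qed

text \<open>The order dual, with non-membership in place of membership. The WD axioms produce joins,
  and primeness of \<open>P\<close> is what makes a join of two elements outside \<open>P\<close>
  stay outside.\<close>

lemma entailment_acoimp:
  assumes A: "WD_algebra A" and P: "P \<in> prime_filters A"
  shows "entailment A (\<lambda>a b. acoimp A a b \<notin> P)"
proof -
  interpret bounded_distrib_lattice A using A by (rule WD_algebra_lattice)
  note coimp_closed = acoimp_closed[OF A]
  have refl: "\<And>a. a \<in> L \<Longrightarrow> acoimp A a a = azero A"
    and meet: "\<And>a b c. a \<in> L \<Longrightarrow> b \<in> L \<Longrightarrow> c \<in> L \<Longrightarrow>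
      acoimp A a (b \<sqinter> c) = acoimp A a b \<squnion> acoimp A a c"
    and join: "\<And>a b c. a \<in> L \<Longrightarrow> b \<in> L \<Longrightarrow> c \<in> L \<Longrightarrow>
      acoimp A (a \<squnion> b) c = acoimp A a c \<squnion> acoimp A b c"
    and trans: "\<And>a b c. a \<in> L \<Longrightarrow> b \<in> L \<Longrightarrow> c \<in> L \<Longrightarrow>
      acoimp A a c \<sqsubseteq> acoimp A a b \<squnion> acoimp A b c"
    using A unfolding WD_algebra_def by blast+
  note join_iff = prime_filter_join_iff[OF P]
  show ?thesis
  proof
    fix a b assume ab: "a \<in> L" "b \<in> L" "a \<sqsubseteq> b"
    have "acoimp A a a \<squnion> acoimp A a b = acoimp A a a"
      using ab meet[of a a b] by (simp add: alg_le_def)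
    then show "acoimp A a b \<notin> P"
      using ab prime_filtersD(3)[OF P] join_iff[of "acoimp A a a" "acoimp A a b"]
      by (simp add: refl coimp_closed)
  next
    fix a b c
    assume abc: "a \<in> L" "b \<in> L" "c \<in> L" "acoimp A a b \<notin> P" "acoimp A b c \<notin> P"
    show "acoimp A a c \<notin> P"
    proof
      assume "acoimp A a c \<in> P"
      then have "acoimp A a b \<squnion> acoimp A b c \<in> P"
        by (rule prime_filtersD(4)[OF P]) (simp_all add: coimp_closed trans abc)
      then show False using abc by (simp add: join_iff coimp_closed)
    qed
  next
    fix a b c assume "a \<in> L" "b \<in> L" "c \<in> L" "acoimp A a c \<notin> P" "acoimp A b c \<notin> P"
    then show "acoimp A (a \<squnion> b) c \<notin> P" by (simp add: join join_iff coimp_closed)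
  next
    fix a b c assume "a \<in> L" "b \<in> L" "c \<in> L" "acoimp A a b \<notin> P" "acoimp A a c \<notin> P"
    then show "acoimp A a (b \<sqinter> c) \<notin> P" by (simp add: meet join_iff coimp_closed)
  qed
qed

section \<open>The relations between prime filters\<close>

lemma X_R_iff: "(P, Q) \<in> X_R A \<longleftrightarrow> P \<in> prime_filters A \<and> Q \<in> prime_filters A \<and>
    (\<forall>a\<in>acar A. \<forall>b\<in>acar A. aimp A a b \<in> P \<and> a \<in> Q \<longrightarrow> b \<in> Q)"
  and X_S_iff: "(P, Q) \<in> X_S A \<longleftrightarrow> P \<in> prime_filters A \<and> Q \<in> prime_filters A \<and>
    (\<forall>a\<in>acar A. \<forall>b\<in>acar A. a \<in> Q \<and> b \<notin> Q \<longrightarrow> acoimp A a b \<in> P)"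
  by (auto simp: X_R_def X_S_def)

text \<open>Used twice: for clopenness of \<open>R\<close>-preimages and for preservation of the
  implication by \<open>sigma\<close>. The substantial inclusion is the existence of a successor
  containing \<open>a\<close> but not \<open>b\<close>, given by separation.\<close>

lemma rpre_X_R:
  assumes A: "WH_algebra A" and ab: "a \<in> acar A" "b \<in> acar A"
  shows "rpre (X_R A) (sigma A a - sigma A b) = prime_filters A - sigma A (aimp A a b)"
proof (intro subset_antisym subsetI)
  fix P assume "P \<in> rpre (X_R A) (sigma A a - sigma A b)"
  then obtain Q where "(P, Q) \<in> X_R A" "Q \<in> sigma A a" "Q \<notin> sigma A b"
    unfolding rpre_def rimg_def by blast
  then show "P \<in> prime_filters A - sigma A (aimp A a b)"
    using ab unfolding X_R_iff sigma_def by blast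
next
  fix P assume P: "P \<in> prime_filters A - sigma A (aimp A a b)"
  then have PA: "P \<in> prime_filters A" and "aimp A a b \<notin> P" by (auto simp: sigma_def)
  from entailment.prime_filter_separation_point[OF entailment_aimp[OF A PA] ab this(2)]
  obtain Q where Q: "prime_filter A Q" "a \<in> Q" "b \<notin> Q"
    "\<And>c d. c \<in> Q \<Longrightarrow> d \<in> acar A \<Longrightarrow> aimp A c d \<in> P \<Longrightarrow> d \<in> Q" by metis
  then have "(P, Q) \<in> X_R A" "Q \<in> sigma A a - sigma A b"
    using PA unfolding X_R_iff prime_filters_def sigma_def by blast+
  then show "P \<in> rpre (X_R A) (sigma A a - sigma A b)"
    unfolding rpre_def rimg_def by blast
qed

lemma rpre_X_S:
  assumes A: "WD_algebra A" and ab: "a \<in> acar A" "b \<in> acar A"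
  shows "rpre (X_S A) (sigma A a - sigma A b) = sigma A (acoimp A a b)"
proof (intro subset_antisym subsetI)
  fix P assume "P \<in> rpre (X_S A) (sigma A a - sigma A b)"
  then obtain Q where "(P, Q) \<in> X_S A" "Q \<in> sigma A a" "Q \<notin> sigma A b"
    unfolding rpre_def rimg_def by blast
  then show "P \<in> sigma A (acoimp A a b)"
    using ab unfolding X_S_iff sigma_def by blast
next
  fix P assume P: "P \<in> sigma A (acoimp A a b)"
  \<comment> \<open>The double negation is kept so that the fact has the shape
    \<open>\<not> E a b\<close> for the entailment
    \<open>\<lambda>a b. acoimp A a b \<notin> P\<close>.\<close>
  then have PA: "P \<in> prime_filters A" and "\<not> acoimp A a b \<notin> P" by (auto simp: sigma_def)
  from entailment.prime_filter_separation_point[OF entailment_acoimp[OF A PA] ab this(2)]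
  obtain Q where Q: "prime_filter A Q" "a \<in> Q" "b \<notin> Q"
    "\<And>c d. c \<in> Q \<Longrightarrow> d \<in> acar A \<Longrightarrow> acoimp A c d \<notin> P \<Longrightarrow> d \<in> Q" by metis
  then have "(P, Q) \<in> X_S A" "Q \<in> sigma A a - sigma A b"
    using PA unfolding X_S_iff prime_filters_def sigma_def by blast+
  then show "P \<in> rpre (X_S A) (sigma A a - sigma A b)"
    unfolding rpre_def rimg_def by blast
qed

text \<open>A pair \<open>a\<close>, \<open>b\<close> that violates the successor condition at
  \<open>Q\<close> violates it on all of \<open>sigma A a - sigma A b\<close>, a neighbourhood of
  \<open>Q\<close>.\<close>

lemma closedin_rimg_X_R:
  assumes A: "WH_algebra A" and P: "P \<in> prime_filters A"
  shows "closedin (X_top A) (rimg (X_R A) P)"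
proof (rule bounded_distrib_lattice.closedin_X_topI[OF WH_algebra_lattice[OF A]])
  fix Q assume "Q \<in> prime_filters A" "Q \<notin> rimg (X_R A) P"
  then obtain a b where "a \<in> acar A" "b \<in> acar A" "aimp A a b \<in> P" "a \<in> Q" "b \<notin> Q"
    using P unfolding rimg_def X_R_iff mem_Collect_eq by blast
  with \<open>Q \<in> prime_filters A\<close> show "\<exists>a\<in>acar A. \<exists>b\<in>acar A. Q \<in> sigma A a - sigma A b \<and>
      (sigma A a - sigma A b) \<inter> rimg (X_R A) P = {}"
    unfolding rimg_def X_R_iff sigma_def by blast
qed (auto simp: rimg_def X_R_iff)

lemma closedin_rimg_X_S:
  assumes A: "WD_algebra A" and P: "P \<in> prime_filters A"
  shows "closedin (X_top A) (rimg (X_S A) P)"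
proof (rule bounded_distrib_lattice.closedin_X_topI[OF WD_algebra_lattice[OF A]])
  fix Q assume "Q \<in> prime_filters A" "Q \<notin> rimg (X_S A) P"
  then obtain a b where "a \<in> acar A" "b \<in> acar A" "acoimp A a b \<notin> P" "a \<in> Q" "b \<notin> Q"
    using P unfolding rimg_def X_S_iff mem_Collect_eq by blast
  with \<open>Q \<in> prime_filters A\<close> show "\<exists>a\<in>acar A. \<exists>b\<in>acar A. Q \<in> sigma A a - sigma A b \<and>
      (sigma A a - sigma A b) \<inter> rimg (X_S A) P = {}"
    unfolding rimg_def X_S_iff sigma_def by blast
qed (auto simp: rimg_def X_S_iff)

text \<open>From \<open>S\<close> to \<open>R\<close>: apply the definition of \<open>X_S\<close> to
  the pair \<open>aimp A a b\<close>, \<open>azero A\<close>, which is admissible as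
  \<open>azero A\<close> lies in no prime filter, and conclude with E1. From \<open>R\<close> to
  \<open>S\<close>: E2 and primeness put \<open>aimp A (aone A) (acoimp A a b)\<close> into
  \<open>P\<close>, and \<open>aone A \<in> Q\<close> detaches the conclusion.\<close>

lemma X_S_eq_converse:
  assumes A: "WHB_algebra A"
  shows "X_S A = converse (X_R A)"
proof -
  interpret bounded_distrib_lattice A using WHB_algebraD(3)[OF A] .
  note imp_closed = aimp_closed[OF WHB_algebraD(1)[OF A]]
    and coimp_closed = acoimp_closed[OF WHB_algebraD(2)[OF A]]
  have E1: "a \<sqinter> acoimp A (aimp A a b) (azero A) \<sqsubseteq> b"
    and E2: "a \<sqsubseteq> b \<squnion> aimp A (aone A) (acoimp A a b)" if "a \<in> L" "b \<in> L" for a b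
    using A that unfolding WHB_algebra_def by blast+
  have "(P, Q) \<in> X_R A" if S: "(Q, P) \<in> X_S A" for P Q
  proof -
    have P: "P \<in> prime_filters A" and Q: "Q \<in> prime_filters A" using S by (auto simp: X_S_iff)
    have "b \<in> Q" if ab: "a \<in> L" "b \<in> L" "aimp A a b \<in> P" "a \<in> Q" for a b
    proof -
      have "acoimp A (aimp A a b) (azero A) \<in> Q"
        using S ab prime_filtersD(3)[OF P] imp_closed zero_closed unfolding X_S_iff by blast
      then have "a \<sqinter> acoimp A (aimp A a b) (azero A) \<in> Q" using prime_filtersD(5)[OF Q ab(4)] by blast
      then show "b \<in> Q" by (rule prime_filtersD(4)[OF Q _ ab(2) E1[OF ab(1,2)]])
    qed
    then show ?thesis using P Q by (auto simp: X_R_iff)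
  qed
  moreover have "(Q, P) \<in> X_S A" if R: "(P, Q) \<in> X_R A" for P Q
  proof -
    have P: "P \<in> prime_filters A" and Q: "Q \<in> prime_filters A" using R by (auto simp: X_R_iff)
    have "acoimp A a b \<in> Q" if ab: "a \<in> L" "b \<in> L" "a \<in> P" "b \<notin> P" for a b
    proof -
      have cl: "acoimp A a b \<in> L" "aimp A (aone A) (acoimp A a b) \<in> L"
        using ab imp_closed coimp_closed by simp_all
      have "b \<squnion> aimp A (aone A) (acoimp A a b) \<in> P"
        using prime_filtersD(4)[OF P ab(3) _ E2[OF ab(1,2)]] ab cl by simp
      then have "aimp A (aone A) (acoimp A a b) \<in> P"
        using ab cl by (simp add: prime_filter_join_iff[OF P])
      then show ?thesis
        using R cl prime_filtersD(2)[OF Q] one_closed unfolding X_R_iff by blast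
    qed
    then show ?thesis using P Q by (auto simp: X_S_iff)
  qed
  ultimately show ?thesis by auto
qed

lemma WHB_space_X_obj:
  assumes A: "WHB_algebra A"
  shows "WHB_space (X_obj A)"
proof -
  interpret bounded_distrib_lattice A using WHB_algebraD(3)[OF A] .
  note WH = WHB_algebraD(1)[OF A] and WD = WHB_algebraD(2)[OF A]
  have "X_R A \<subseteq> prime_filters A \<times> prime_filters A" "X_S A \<subseteq> prime_filters A \<times> prime_filters A"
    by (auto simp: X_R_iff X_S_iff)
  moreover have "(P, Z) \<in> X_R A" if "P \<in> prime_filters A" "P \<subseteq> Q" "(Q, Z) \<in> X_R A" for P Q Z
    using that unfolding X_R_iff by blast
  moreover have "(Q, Z) \<in> X_S A" if "Q \<in> prime_filters A" "P \<subseteq> Q" "(P, Z) \<in> X_S A" for P Q Z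
    using that unfolding X_S_iff by blast
  ultimately have "WHB_frame (X_obj A)"
    unfolding WHB_frame_def X_obj_simps topspace_X_top using X_S_eq_converse[OF A] by blast
  moreover have "clopen_in (X_top A) (rpre (X_R A) U)" "clopen_in (X_top A) (rpre (X_S A) U)"
    if "clopen_in (X_top A) U" for U
  proof -
    show "clopen_in (X_top A) (rpre (X_R A) U)"
    proof (rule clopen_rpreI[OF _ that])
      fix a b assume "a \<in> L" "b \<in> L"
      then show "clopen_in (X_top A) (rpre (X_R A) (sigma A a - sigma A b))"
        using clopen_in_diff[OF clopen_in_topspace clopen_sigma[OF aimp_closed[OF WH]]]
        by (simp add: rpre_X_R[OF WH])
    qed
    show "clopen_in (X_top A) (rpre (X_S A) U)"
    proof (rule clopen_rpreI[OF _ that])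
      fix a b assume "a \<in> L" "b \<in> L"
      then show "clopen_in (X_top A) (rpre (X_S A) (sigma A a - sigma A b))"
        using clopen_sigma[OF acoimp_closed[OF WD]] by (simp add: rpre_X_S[OF WD])
    qed
  qed
  ultimately show ?thesis
    using closedin_rimg_X_R[OF WH] closedin_rimg_X_S[OF WD] priestley_space_X_obj
    by (simp add: WHB_space_def)
qed

section \<open>Homomorphisms and their dual maps\<close>

lemma alg_hom_closed: "alg_hom h A B \<Longrightarrow> a \<in> acar A \<Longrightarrow> h a \<in> acar B"
  by (simp add: alg_hom_def)

lemma alg_homD:
  assumes "alg_hom h A B" "a \<in> acar A" "b \<in> acar A"
  shows "h (ameet A a b) = ameet B (h a) (h b)"
    "h (ajoin A a b) = ajoin B (h a) (h b)" "h (aimp A a b) = aimp B (h a) (h b)"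
    "h (acoimp A a b) = acoimp B (h a) (h b)"
  using assms unfolding alg_hom_def by blast+

lemma alg_hom_le:
  assumes "alg_hom h A B" "a \<in> acar A" "b \<in> acar A" "alg_le A a b"
  shows "alg_le B (h a) (h b)"
  using assms alg_homD(1)[OF assms(1-3)] by (simp add: alg_le_def)

lemma X_mor_prime_filter:
  assumes A: "bounded_distrib_lattice A" and h: "alg_hom h A B" and P: "P \<in> prime_filters B"
  shows "X_mor A h P \<in> prime_filters A"
proof -
  interpret bounded_distrib_lattice A by fact
  have "h (aone A) = aone B" "h (azero A) = azero B" using h by (auto simp: alg_hom_def)
  then show ?thesis
    unfolding prime_filters_def prime_filter_def mem_Collect_eq
    using prime_filtersD[OF P] alg_hom_le[OF h] alg_hom_closed[OF h] alg_homD[OF h]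
    by (auto simp: X_mor_def)
qed

text \<open>Gives both continuity of \<open>X_mor A h\<close>, checked on the subbase, and
  naturality of \<open>sigma\<close>.\<close>

lemma vimage_X_mor_sigma:
  assumes A: "bounded_distrib_lattice A" and h: "alg_hom h A B" and a: "a \<in> acar A"
  shows "{P \<in> prime_filters B. X_mor A h P \<in> sigma A a} = sigma B (h a)"
  using X_mor_prime_filter[OF A h] a by (auto simp: sigma_def X_mor_def)

text \<open>Both back conditions extend \<open>h ` Z\<close> to a prime filter of \<open>B\<close> avoiding \<open>h ` (A - Z)\<close>.\<close>

lemma X_mor_back:
  assumes A: "bounded_distrib_lattice A" and h: "alg_hom h A B" and E: "entailment B E"
    and Z: "Z \<in> prime_filters A"
    and reflect: "\<And>a b. a \<in> Z \<Longrightarrow> b \<in> acar A \<Longrightarrow> E (h a) (h b) \<Longrightarrow> b \<in> Z"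
  obtains Q where "Q \<in> prime_filters B" "X_mor A h Q = Z"
    "\<And>a b. a \<in> Q \<Longrightarrow> b \<in> acar B \<Longrightarrow> E a b \<Longrightarrow> b \<in> Q"
proof -
  interpret bounded_distrib_lattice A by fact
  have ZL: "Z \<subseteq> L" using prime_filtersD(1)[OF Z] .
  have "\<exists>Q. prime_filter B Q \<and> h ` Z \<subseteq> Q \<and> Q \<inter> h ` (L - Z) = {} \<and>
    (\<forall>a\<in>Q. \<forall>b\<in>acar B. E a b \<longrightarrow> b \<in> Q)"
  proof (rule entailment.prime_filter_separation[OF E, of "h ` Z" "h ` (L - Z)"])
    show "h ` Z \<subseteq> acar B" "h ` (L - Z) \<subseteq> acar B" using alg_hom_closed[OF h] ZL by auto
    show "h ` Z \<noteq> {}" "h ` (L - Z) \<noteq> {}"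
      using prime_filtersD(2,3)[OF Z] zero_closed by blast+
    show "ameet B x y \<in> h ` Z" if "x \<in> h ` Z" "y \<in> h ` Z" for x y
    proof -
      obtain a b where *: "a \<in> Z" "b \<in> Z" "x = h a" "y = h b" using \<open>x \<in> _\<close> \<open>y \<in> _\<close> by blast
      then have "ameet B x y = h (a \<sqinter> b)" using alg_homD(1)[OF h, of a b, symmetric] ZL by auto
      then show ?thesis using prime_filtersD(5)[OF Z] * by blast
    qed
    show "ajoin B x y \<in> h ` (L - Z)" if "x \<in> h ` (L - Z)" "y \<in> h ` (L - Z)" for x y
    proof -
      obtain a b where *: "a \<in> L - Z" "b \<in> L - Z" "x = h a" "y = h b" using \<open>x \<in> _\<close> \<open>y \<in> _\<close> by blast
      then have "ajoin B x y = h (a \<squnion> b)" using alg_homD(2)[OF h, of a b, symmetric] by auto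
      moreover have "a \<squnion> b \<in> L - Z" using * prime_filter_join_iff[OF Z] by auto
      ultimately show ?thesis by blast
    qed
    show "\<not> E x y" if "x \<in> h ` Z" "y \<in> h ` (L - Z)" for x y
      using that reflect by blast
  qed blast
  then obtain Q where Q: "prime_filter B Q" "h ` Z \<subseteq> Q" "Q \<inter> h ` (L - Z) = {}"
    "\<forall>a\<in>Q. \<forall>b\<in>acar B. E a b \<longrightarrow> b \<in> Q" by blast
  show thesis
  proof (rule that)
    show "Q \<in> prime_filters B" using Q by (simp add: prime_filters_def)
    show "X_mor A h Q = Z" using Q ZL by (auto simp: X_mor_def)
  qed (use Q in blast)
qed

lemma WHBS_morphism_X_mor:
  assumes A: "WHB_algebra A" and B: "WHB_algebra B" and h: "alg_hom h A B"
  shows "WHBS_morphism (X_mor A h) (X_obj B) (X_obj A)"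
proof -
  note AL = WHB_algebraD(3)[OF A]
  note pf = X_mor_prime_filter[OF AL h]
  interpret bounded_distrib_lattice A by (rule AL)
  have "continuous_map (X_top B) (X_top A) (X_mor A h)"
    unfolding X_top_def[of A]
  proof (rule continuous_on_generated_topo)
    fix U assume "U \<in> insert (prime_filters A) (sigma A ` L \<union> (\<lambda>a. prime_filters A - sigma A a) ` L)"
    then consider "U = prime_filters A" | a where "a \<in> L" "U = sigma A a"
      | a where "a \<in> L" "U = prime_filters A - sigma A a" by blast
    then show "openin (X_top B) (X_mor A h -` U \<inter> topspace (X_top B))"
    proof cases
      case 1
      then have "X_mor A h -` U \<inter> topspace (X_top B) = topspace (X_top B)" using pf by auto
      then show ?thesis using openin_topspace by metis
    next
      case 2
      then have "X_mor A h -` U \<inter> topspace (X_top B) = sigma B (h a)"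
        using vimage_X_mor_sigma[OF AL h] by auto
      then show ?thesis using openin_sigma alg_hom_closed[OF h] 2 by metis
    next
      case 3
      then have "X_mor A h -` U \<inter> topspace (X_top B) = prime_filters B - sigma B (h a)"
        using vimage_X_mor_sigma[OF AL h] pf by auto
      then show ?thesis using openin_compl_sigma alg_hom_closed[OF h] 3 by metis
    qed
  qed (use pf in auto)
  moreover have "(X_mor A h P, X_mor A h Q) \<in> X_R A" if "(P, Q) \<in> X_R B" for P Q
    unfolding X_R_iff
  proof (intro conjI ballI impI)
    fix a b assume "a \<in> L" "b \<in> L" "aimp A a b \<in> X_mor A h P \<and> a \<in> X_mor A h Q"
    then have "aimp B (h a) (h b) \<in> P" "h a \<in> Q" "h a \<in> acar B" "h b \<in> acar B"
      using alg_hom_closed[OF h] alg_homD(3)[OF h] by (simp_all add: X_mor_def)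
    with that \<open>b \<in> L\<close> show "b \<in> X_mor A h Q" unfolding X_R_iff X_mor_def by blast
  qed (use that pf in \<open>auto simp: X_R_iff\<close>)
  moreover have "(X_mor A h P, X_mor A h Q) \<in> X_S A" if "(P, Q) \<in> X_S B" for P Q
    unfolding X_S_iff
  proof (intro conjI ballI impI)
    fix a b assume ab: "a \<in> L" "b \<in> L" "a \<in> X_mor A h Q \<and> b \<notin> X_mor A h Q"
    then have "h a \<in> Q" "h b \<notin> Q" "h a \<in> acar B" "h b \<in> acar B"
      using alg_hom_closed[OF h] by (simp_all add: X_mor_def)
    with that have "acoimp B (h a) (h b) \<in> P" unfolding X_S_iff by blast
    with ab show "acoimp A a b \<in> X_mor A h P"
      using alg_homD(4)[OF h] acoimp_closed[OF WHB_algebraD(2)[OF A]] by (simp add: X_mor_def)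
  qed (use that pf in \<open>auto simp: X_S_iff\<close>)
  moreover have "\<exists>Q\<in>rimg (X_R B) P. X_mor A h Q = Z"
    if P: "P \<in> prime_filters B" and Z: "(X_mor A h P, Z) \<in> X_R A" for P Z
  proof -
    \<comment> \<open>The reflection hypothesis of \<open>X_mor_back\<close>: since \<open>h\<close>
      preserves the implication, an entailment between images at \<open>P\<close> is an implication
      in \<open>X_mor A h P\<close>, which the successor \<open>Z\<close> respects.\<close>
    have "b \<in> Z" if ab: "a \<in> Z" "b \<in> L" "aimp B (h a) (h b) \<in> P" for a b
    proof -
      have a: "a \<in> L" using ab prime_filtersD(1) Z by (auto simp: X_R_iff)
      then have "aimp A a b \<in> X_mor A h P"
        using ab alg_homD(3)[OF h] aimp_closed[OF WHB_algebraD(1)[OF A]] by (simp add: X_mor_def)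
      then show ?thesis using Z a ab unfolding X_R_iff by blast
    qed
    then obtain Q where "Q \<in> prime_filters B" "X_mor A h Q = Z"
      "\<And>a b. a \<in> Q \<Longrightarrow> b \<in> acar B \<Longrightarrow> aimp B a b \<in> P \<Longrightarrow> b \<in> Q"
      using X_mor_back[OF AL h entailment_aimp[OF WHB_algebraD(1)[OF B] P], of Z] Z
      unfolding X_R_iff by metis
    then show ?thesis using P by (auto simp: rimg_def X_R_iff)
  qed
  moreover have "\<exists>Q\<in>rimg (X_S B) P. X_mor A h Q = Z"
    if P: "P \<in> prime_filters B" and Z: "(X_mor A h P, Z) \<in> X_S A" for P Z
  proof -
    have "b \<in> Z" if ab: "a \<in> Z" "b \<in> L" "acoimp B (h a) (h b) \<notin> P" for a b
    proof -
      have a: "a \<in> L" using ab prime_filtersD(1) Z by (auto simp: X_S_iff)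
      then have "acoimp A a b \<notin> X_mor A h P"
        using ab alg_homD(4)[OF h] by (simp add: X_mor_def)
      then show ?thesis using Z a ab unfolding X_S_iff by blast
    qed
    then obtain Q where "Q \<in> prime_filters B" "X_mor A h Q = Z"
      "\<And>a b. a \<in> Q \<Longrightarrow> b \<in> acar B \<Longrightarrow> acoimp B a b \<notin> P \<Longrightarrow> b \<in> Q"
      using X_mor_back[OF AL h entailment_acoimp[OF WHB_algebraD(2)[OF B] P], of Z] Z
      unfolding X_S_iff by metis
    then show ?thesis using P by (auto simp: rimg_def X_S_iff)
  qed
  moreover have "X_mor A h P \<subseteq> X_mor A h Q" if "P \<subseteq> Q" for P Q
    using that by (auto simp: X_mor_def)
  ultimately show ?thesis by (simp add: WHBS_morphism_def)
qed

section \<open>The algebra of clopen upsets\<close>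

lemma D_obj_simps [simp]:
  "acar (D_obj X) = clopen_upsets X" "ameet (D_obj X) = (\<inter>)" "ajoin (D_obj X) = (\<union>)"
  "aimp (D_obj X) = imp_R X" "acoimp (D_obj X) = coimp_S X" "azero (D_obj X) = {}"
  "aone (D_obj X) = pts X"
  by (simp_all add: D_obj_def)

lemma alg_le_D_obj [simp]: "alg_le (D_obj X) U V \<longleftrightarrow> U \<subseteq> V"
  by (auto simp: alg_le_def)

lemma clopen_upsetsD:
  assumes "U \<in> clopen_upsets X"
  shows "clopen_in (stop X) U" "openin (stop X) U" "U \<subseteq> pts X"
    "\<And>x y. x \<in> U \<Longrightarrow> y \<in> pts X \<Longrightarrow> sle X x y \<Longrightarrow> y \<in> U"
  using assms by (auto simp: clopen_upsets_def is_upset_def clopen_in_def)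

lemma clopen_upsets_Un: "U \<in> clopen_upsets X \<Longrightarrow> V \<in> clopen_upsets X \<Longrightarrow> U \<union> V \<in> clopen_upsets X"
  and clopen_upsets_Int: "U \<in> clopen_upsets X \<Longrightarrow> V \<in> clopen_upsets X \<Longrightarrow> U \<inter> V \<in> clopen_upsets X"
  by (auto simp: clopen_upsets_def is_upset_def clopen_in_Un clopen_in_Int)

lemma clopen_upsets_bounds [simp]: "{} \<in> clopen_upsets X" "pts X \<in> clopen_upsets X"
  by (auto simp: clopen_upsets_def is_upset_def)

lemma bdl_D_obj: "bdl (D_obj X)"
  unfolding bdl_def D_obj_simps
  by (intro conjI ballI) (auto simp: clopen_upsets_Un clopen_upsets_Int dest: clopen_upsetsD(3))

text \<open>Rewrites the operation through the preimage of \<open>U - V\<close>. This set is clopen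
  though in general not an upset, so the preimage axioms of a WHB-space apply; on prime filters the
  same form matches \<open>rpre_X_R\<close>.\<close>

lemma imp_R_eq_rpre: "imp_R X U V = pts X - rpre (sR X) (U - V)"
  by (auto simp: imp_R_def rpre_def)

lemma coimp_S_eq_rpre: "coimp_S X U V = pts X \<inter> rpre (sS X) (U - V)"
  by (auto simp: coimp_S_def rpre_def)

lemma priestley_spaceD:
  assumes "priestley_space X"
  shows "compact_space (stop X)"
    "\<And>x y. x \<in> pts X \<Longrightarrow> y \<in> pts X \<Longrightarrow> sle X x y \<Longrightarrow> sle X y x \<Longrightarrow> x = y"
    "\<And>x y. x \<in> pts X \<Longrightarrow> y \<in> pts X \<Longrightarrow> \<not> sle X x y \<Longrightarrow>
      \<exists>U\<in>clopen_upsets X. x \<in> U \<and> y \<notin> U"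
proof -
  have anti: "\<forall>x\<in>pts X. \<forall>y\<in>pts X. sle X x y \<and> sle X y x \<longrightarrow> x = y"
    using assms unfolding priestley_space_def by (elim conjE)
  have sep: "\<forall>x\<in>pts X. \<forall>y\<in>pts X. \<not> sle X x y \<longrightarrow>
      (\<exists>U. clopen_in (stop X) U \<and> is_upset X U \<and> x \<in> U \<and> y \<notin> U)"
    using assms unfolding priestley_space_def by (elim conjE)
  show "compact_space (stop X)"
    using assms unfolding priestley_space_def by (elim conjE)
  show "x = y" if "x \<in> pts X" "y \<in> pts X" "sle X x y" "sle X y x" for x y
    using anti that by blast
  show "\<exists>U\<in>clopen_upsets X. x \<in> U \<and> y \<notin> U" if "x \<in> pts X" "y \<in> pts X" "\<not> sle X x y" for x y
    using sep that unfolding clopen_upsets_def by blast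
qed

lemma WHB_spaceD:
  assumes "WHB_space X"
  shows "priestley_space X" "WHB_frame X"
    "\<And>x. x \<in> pts X \<Longrightarrow> closedin (stop X) (rimg (sR X) x)"
    "\<And>U. clopen_in (stop X) U \<Longrightarrow> clopen_in (stop X) (rpre (sR X) U)"
    "\<And>U. clopen_in (stop X) U \<Longrightarrow> clopen_in (stop X) (rpre (sS X) U)"
  using assms by (simp_all add: WHB_space_def)

lemma WHB_frameD:
  assumes "WHB_frame X"
  shows "\<And>x y. (x, y) \<in> sR X \<Longrightarrow> x \<in> pts X \<and> y \<in> pts X" "sS X = converse (sR X)"
    "\<And>x y z. x \<in> pts X \<Longrightarrow> sle X x y \<Longrightarrow> (y, z) \<in> sR X \<Longrightarrow> (x, z) \<in> sR X"
    "\<And>x y z. y \<in> pts X \<Longrightarrow> sle X x y \<Longrightarrow> (x, z) \<in> sS X \<Longrightarrow> (y, z) \<in> sS X"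
  using assms unfolding WHB_frame_def by blast+

lemma imp_R_clopen_upset:
  assumes X: "WHB_space X" and UV: "U \<in> clopen_upsets X" "V \<in> clopen_upsets X"
  shows "imp_R X U V \<in> clopen_upsets X"
proof -
  have "clopen_in (stop X) (imp_R X U V)"
    unfolding imp_R_eq_rpre using UV
    by (intro clopen_in_diff clopen_in_topspace WHB_spaceD(4)[OF X]) (auto dest: clopen_upsetsD)
  moreover have "is_upset X (imp_R X U V)"
    unfolding is_upset_def imp_R_def rimg_def using WHB_frameD(3)[OF WHB_spaceD(2)[OF X]] by blast
  ultimately show ?thesis by (simp add: clopen_upsets_def)
qed

lemma coimp_S_clopen_upset:
  assumes X: "WHB_space X" and UV: "U \<in> clopen_upsets X" "V \<in> clopen_upsets X"
  shows "coimp_S X U V \<in> clopen_upsets X"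
proof -
  have "clopen_in (stop X) (coimp_S X U V)"
    unfolding coimp_S_eq_rpre using UV
    by (intro clopen_in_Int clopen_in_topspace WHB_spaceD(5)[OF X] clopen_in_diff)
      (auto dest: clopen_upsetsD)
  moreover have "is_upset X (coimp_S X U V)"
    unfolding is_upset_def coimp_S_def rimg_def using WHB_frameD(4)[OF WHB_spaceD(2)[OF X]] by blast
  ultimately show ?thesis by (simp add: clopen_upsets_def)
qed

text \<open>The WH and WD identities are set theory for an arbitrary relation, whereas E1 and E2
  rest on \<open>S\<close> being the converse of \<open>R\<close>.\<close>

lemma WHB_algebra_D_obj:
  assumes X: "WHB_space X"
  shows "WHB_algebra (D_obj X)"
proof -
  note S = WHB_frameD(2)[OF WHB_spaceD(2)[OF X]]
  have "WH_algebra (D_obj X)"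
    unfolding WH_algebra_def alg_le_D_obj D_obj_simps
  proof (intro conjI ballI bdl_D_obj imp_R_clopen_upset[OF X])
    fix U V W
    show "imp_R X U U = pts X" "imp_R X U (V \<inter> W) = imp_R X U V \<inter> imp_R X U W"
      "imp_R X (U \<union> V) W = imp_R X U W \<inter> imp_R X V W" "imp_R X U V \<inter> imp_R X V W \<subseteq> imp_R X U W"
      unfolding imp_R_def by blast+
  qed
  moreover have "WD_algebra (D_obj X)"
    unfolding WD_algebra_def alg_le_D_obj D_obj_simps
  proof (intro conjI ballI bdl_D_obj coimp_S_clopen_upset[OF X])
    fix U V W
    show "coimp_S X U U = {}" "coimp_S X (U \<union> V) W = coimp_S X U W \<union> coimp_S X V W"
      "coimp_S X U (V \<inter> W) = coimp_S X U V \<union> coimp_S X U W"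
      "coimp_S X U W \<subseteq> coimp_S X U V \<union> coimp_S X V W"
      unfolding coimp_S_def by blast+
  qed
  \<comment> \<open>For E1, an \<open>S\<close>-successor \<open>y\<close> of \<open>x\<close> has
    \<open>x\<close> among its \<open>R\<close>-successors, so \<open>y\<close> in
    \<open>imp_R X U V\<close> and \<open>x \<in> U\<close> give \<open>x \<in> V\<close>. For E2,
    if \<open>x \<in> U - V\<close>, then \<open>x\<close> is an \<open>S\<close>-successor of each
    of its \<open>R\<close>-successors.\<close>
  moreover have "U \<inter> coimp_S X (imp_R X U V) {} \<subseteq> V" for U V
    unfolding imp_R_def coimp_S_def rimg_def S by blast
  moreover have "U \<subseteq> V \<union> imp_R X (pts X) (coimp_S X U V)" if "U \<in> clopen_upsets X" for U V
    using clopen_upsetsD(3)[OF that] WHB_frameD(1)[OF WHB_spaceD(2)[OF X]]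
    unfolding imp_R_def coimp_S_def rimg_def S by blast
  ultimately show ?thesis by (simp add: WHB_algebra_def)
qed

section \<open>Morphisms of spaces and their dual homomorphisms\<close>

lemma WHBS_morphismD:
  assumes "WHBS_morphism f X Y"
  shows "continuous_map (stop X) (stop Y) f"
    "\<And>x y. x \<in> pts X \<Longrightarrow> y \<in> pts X \<Longrightarrow> sle X x y \<Longrightarrow> sle Y (f x) (f y)"
    "\<And>x y. (x, y) \<in> sR X \<Longrightarrow> (f x, f y) \<in> sR Y"
    "\<And>x z. x \<in> pts X \<Longrightarrow> (f x, z) \<in> sR Y \<Longrightarrow> \<exists>y. (x, y) \<in> sR X \<and> f y = z"
    "\<And>x y. (x, y) \<in> sS X \<Longrightarrow> (f x, f y) \<in> sS Y"
    "\<And>x z. x \<in> pts X \<Longrightarrow> (f x, z) \<in> sS Y \<Longrightarrow> \<exists>y. (x, y) \<in> sS X \<and> f y = z"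
    "\<And>x. x \<in> pts X \<Longrightarrow> f x \<in> pts Y"
  using assms unfolding WHBS_morphism_def
  by (auto simp: rimg_def continuous_map_def)

lemma WHBS_morphismI:
  assumes "continuous_map (stop X) (stop Y) f"
    "\<And>x y. x \<in> pts X \<Longrightarrow> y \<in> pts X \<Longrightarrow> sle X x y \<Longrightarrow> sle Y (f x) (f y)"
    "\<And>x y. (x, y) \<in> sR X \<Longrightarrow> (f x, f y) \<in> sR Y"
    "\<And>x z. x \<in> pts X \<Longrightarrow> (f x, z) \<in> sR Y \<Longrightarrow> \<exists>y. (x, y) \<in> sR X \<and> f y = z"
    "\<And>x y. (x, y) \<in> sS X \<Longrightarrow> (f x, f y) \<in> sS Y"
    "\<And>x z. x \<in> pts X \<Longrightarrow> (f x, z) \<in> sS Y \<Longrightarrow> \<exists>y. (x, y) \<in> sS X \<and> f y = z"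
  shows "WHBS_morphism f X Y"
  using assms by (simp add: WHBS_morphism_def rimg_def Bex_def)

text \<open>Each of the two implications needs both halves of the morphism condition. For
  \<open>imp_R\<close>, a universal statement about successors, the forth condition gives the
  inclusion from left to right and the back condition the converse; for the existential
  \<open>coimp_S\<close> the roles are exchanged.\<close>

lemma alg_hom_D_mor:
  assumes X: "WHB_space X" and f: "WHBS_morphism f X Y"
  shows "alg_hom (D_mor X f) (D_obj Y) (D_obj X)"
  unfolding alg_hom_def D_obj_simps
proof (intro conjI ballI)
  note mor = WHBS_morphismD[OF f] and frame = WHB_frameD(1,2)[OF WHB_spaceD(2)[OF X]]
  fix U V
  show "D_mor X f U \<in> clopen_upsets X" if U: "U \<in> clopen_upsets Y"
  proof -
    have "openin (stop X) (D_mor X f U)" "closedin (stop X) (D_mor X f U)"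
      unfolding D_mor_def using clopen_upsetsD(1)[OF U] mor(1)
      by (auto simp: clopen_in_def openin_continuous_map_preimage closedin_continuous_map_preimage)
    moreover have "is_upset X (D_mor X f U)"
      using clopen_upsetsD(4)[OF U] mor(2,7) by (auto simp: is_upset_def D_mor_def)
    ultimately show ?thesis by (simp add: clopen_upsets_def clopen_in_def)
  qed
  show "D_mor X f (U \<inter> V) = D_mor X f U \<inter> D_mor X f V" "D_mor X f (U \<union> V) = D_mor X f U \<union> D_mor X f V"
    "D_mor X f {} = {}" "D_mor X f (pts Y) = pts X"
    using mor(7) by (auto simp: D_mor_def)
  show "D_mor X f (imp_R Y U V) = imp_R X (D_mor X f U) (D_mor X f V)"
    unfolding D_mor_def imp_R_def rimg_def using mor(3,4,7) frame(1) by blast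
  have "sS X \<subseteq> pts X \<times> pts X" unfolding frame(2) using frame(1) by blast
  then show "D_mor X f (coimp_S Y U V) = coimp_S X (D_mor X f U) (D_mor X f V)"
    unfolding D_mor_def coimp_S_def rimg_def using mor(5,6,7) by blast
qed

section \<open>The unit isomorphisms\<close>

text \<open>\<open>g\<close> cancels \<open>h\<close> only on the carrier; closure of the carrier
  under all operations lets it cancel on compound terms, so the set-theoretic inverse is again a
  homomorphism.\<close>

lemma alg_isoI:
  assumes A: "WHB_algebra A" and h: "alg_hom h A B" and inj: "inj_on h (acar A)"
    and surj: "h ` acar A = acar B"
  shows "alg_iso h A B"
proof -
  interpret bounded_distrib_lattice A using WHB_algebraD(3)[OF A] .
  define g where "g = inv_into (acar A) h"
  have gh: "g (h a) = a" if "a \<in> L" for a using that inj by (simp add: g_def)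
  have g: "g b \<in> L" "h (g b) = b" if "b \<in> acar B" for b
    using that surj by (auto simp: g_def inv_into_into f_inv_into_f)
  note op = alg_homD[OF h, symmetric]
  have bounds: "aone B = h (aone A)" "azero B = h (azero A)" using h by (auto simp: alg_hom_def)
  have "g (ameet B x y) = g x \<sqinter> g y \<and> g (ajoin B x y) = g x \<squnion> g y \<and>
      g (aimp B x y) = aimp A (g x) (g y) \<and> g (acoimp B x y) = acoimp A (g x) (g y)"
    if xy: "x \<in> acar B" "y \<in> acar B" for x y
  proof -
    have L: "g x \<in> L" "g y \<in> L" using g xy by blast+
    have "ameet B x y = h (g x \<sqinter> g y)" "ajoin B x y = h (g x \<squnion> g y)"
      "aimp B x y = h (aimp A (g x) (g y))" "acoimp B x y = h (acoimp A (g x) (g y))"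
      using op[OF L] g(2) xy by simp_all
    then show ?thesis
      using L aimp_closed[OF WHB_algebraD(1)[OF A]] acoimp_closed[OF WHB_algebraD(2)[OF A]]
      by (simp add: gh)
  qed
  then have "alg_hom g B A"
    unfolding alg_hom_def using g gh bounds by simp
  then show ?thesis unfolding alg_iso_def using h g gh by blast
qed

lemma alg_iso_sigma:
  assumes A: "WHB_algebra A"
  shows "alg_iso (sigma A) A (D_obj (X_obj A))"
proof (rule alg_isoI[OF A])
  interpret bounded_distrib_lattice A using WHB_algebraD(3)[OF A] .
  have clopen: "sigma A a \<in> clopen_upsets (X_obj A)" if "a \<in> L" for a
    using clopen_sigma[OF that] by (auto simp: clopen_upsets_def is_upset_def sigma_def)
  show "inj_on (sigma A) L"
    using sigma_subset_iff le_antisym by (intro inj_onI) (metis subset_refl)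
  show "sigma A ` L = acar (D_obj (X_obj A))"
    using clopen clopen_upset_eq_sigma by (auto simp del: X_obj_simps) blast
  have imp: "sigma A (aimp A a b) = imp_R (X_obj A) (sigma A a) (sigma A b)" if "a \<in> L" "b \<in> L" for a b
    using that rpre_X_R[OF WHB_algebraD(1)[OF A]] sigma_subset[of A "aimp A a b"]
    by (auto simp: imp_R_eq_rpre)
  have coimp: "sigma A (acoimp A a b) = coimp_S (X_obj A) (sigma A a) (sigma A b)" if "a \<in> L" "b \<in> L" for a b
    using that rpre_X_S[OF WHB_algebraD(2)[OF A]] sigma_subset[of A "acoimp A a b"]
    by (auto simp: coimp_S_eq_rpre)
  show "alg_hom (sigma A) A (D_obj (X_obj A))"
    unfolding alg_hom_def using clopen sigma_meet sigma_join sigma_one sigma_zero imp coimp by simp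
qed

section \<open>Points of a space as prime filters of clopen upsets\<close>

lemma Hausdorff_priestley_space:
  assumes "priestley_space X"
  shows "Hausdorff_space (stop X)"
  unfolding Hausdorff_space_def
proof (intro allI impI, elim conjE)
  fix x y assume xy: "x \<in> pts X" "y \<in> pts X" "x \<noteq> y"
  then have "\<not> sle X x y \<or> \<not> sle X y x" using priestley_spaceD(2)[OF assms] by blast
  then obtain U where U: "U \<in> clopen_upsets X" "x \<in> U \<and> y \<notin> U \<or> y \<in> U \<and> x \<notin> U"
    using priestley_spaceD(3)[OF assms] xy by metis
  have "openin (stop X) U" "openin (stop X) (pts X - U)"
    using clopen_upsetsD(1)[OF U(1)] by (auto simp: clopen_in_def)
  moreover have "disjnt U (pts X - U)" "disjnt (pts X - U) U" by (auto simp: disjnt_def)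
  moreover have "x \<in> U \<and> y \<in> pts X - U \<or> x \<in> pts X - U \<and> y \<in> U" using U(2) xy by blast
  ultimately show "\<exists>U V. openin (stop X) U \<and> openin (stop X) V \<and> x \<in> U \<and> y \<in> V \<and> disjnt U V"
    by blast
qed

text \<open>For a bijection that preserves and reflects \<open>R\<close>, the back condition is
  witnessed by the inverse image of the given successor. \<open>S\<close> is not assumed separately:
  in both frames it is the converse of \<open>R\<close>.\<close>

lemma space_isoI:
  assumes homeo: "homeomorphic_map (stop X) (stop Y) f"
    and ord: "\<And>x y. x \<in> pts X \<Longrightarrow> y \<in> pts X \<Longrightarrow> sle X x y \<longleftrightarrow> sle Y (f x) (f y)"
    and X: "WHB_frame X" and Y: "WHB_frame Y"
    and R: "\<And>x y. x \<in> pts X \<Longrightarrow> y \<in> pts X \<Longrightarrow> (x, y) \<in> sR X \<longleftrightarrow> (f x, f y) \<in> sR Y"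
  shows "space_iso f X Y"
proof -
  obtain g where g: "homeomorphic_maps (stop X) (stop Y) f g"
    using homeo unfolding homeomorphic_map_maps by blast
  then have cont: "continuous_map (stop X) (stop Y) f" "continuous_map (stop Y) (stop X) g"
    and gf: "\<And>x. x \<in> pts X \<Longrightarrow> g (f x) = x" and fg: "\<And>y. y \<in> pts Y \<Longrightarrow> f (g y) = y"
    unfolding homeomorphic_maps_def by blast+
  then have fY: "\<And>x. x \<in> pts X \<Longrightarrow> f x \<in> pts Y" and gX: "\<And>y. y \<in> pts Y \<Longrightarrow> g y \<in> pts X"
    unfolding continuous_map_def by blast+
  have RX: "x \<in> pts X" "y \<in> pts X" if "(x, y) \<in> sR X" for x y
    using WHB_frameD(1)[OF X that] by simp_all
  have RY: "x \<in> pts Y" "y \<in> pts Y" if "(x, y) \<in> sR Y" for x y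
    using WHB_frameD(1)[OF Y that] by simp_all
  have R_g: "(g x, g y) \<in> sR X" if "(x, y) \<in> sR Y" for x y
    using R[OF gX gX, OF RY[OF that]] fg[OF RY(1)[OF that]] fg[OF RY(2)[OF that]] that by simp
  have ord_g: "sle X (g x) (g y)" if "x \<in> pts Y" "y \<in> pts Y" "sle Y x y" for x y
    using ord[OF gX gX, OF that(1,2)] fg that by simp
  have "WHBS_morphism f X Y"
  proof (rule WHBS_morphismI)
    show "(f x, f y) \<in> sR Y" if "(x, y) \<in> sR X" for x y using that R RX by blast
    show "(f x, f y) \<in> sS Y" if "(x, y) \<in> sS X" for x y
      using that R RX unfolding WHB_frameD(2)[OF X] WHB_frameD(2)[OF Y] by blast
    show "\<exists>y. (x, y) \<in> sR X \<and> f y = z" if "x \<in> pts X" "(f x, z) \<in> sR Y" for x z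
      using R_g[OF that(2)] gf that(1) fg[OF RY(2)[OF that(2)]] by auto
    show "\<exists>y. (x, y) \<in> sS X \<and> f y = z" if "x \<in> pts X" "(f x, z) \<in> sS Y" for x z
    proof -
      have "(z, f x) \<in> sR Y" using that(2) unfolding WHB_frameD(2)[OF Y] by blast
      then show ?thesis
        using R_g[of z "f x"] gf that(1) fg[OF RY(1)] unfolding WHB_frameD(2)[OF X] by auto
    qed
  qed (use cont ord in auto)
  moreover have "WHBS_morphism g Y X"
  proof (rule WHBS_morphismI)
    show "(g x, g y) \<in> sS X" if "(x, y) \<in> sS Y" for x y
      using that R_g unfolding WHB_frameD(2)[OF X] WHB_frameD(2)[OF Y] by blast
    show "\<exists>y. (x, y) \<in> sR Y \<and> g y = z" if x: "x \<in> pts Y" and z: "(g x, z) \<in> sR X" for x z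
      using R[OF RX[OF z]] z fg[OF x] gf[OF RX(2)[OF z]] by auto
    show "\<exists>y. (x, y) \<in> sS Y \<and> g y = z" if x: "x \<in> pts Y" and "(g x, z) \<in> sS X" for x z
    proof -
      have z: "(z, g x) \<in> sR X" using that(2) unfolding WHB_frameD(2)[OF X] by blast
      then show ?thesis
        using R[OF RX[OF z]] fg[OF x] gf[OF RX(1)[OF z]] unfolding WHB_frameD(2)[OF Y] by auto
    qed
  qed (use cont ord_g R_g in auto)
  ultimately show ?thesis unfolding space_iso_def using gf fg by blast
qed

lemma mem_epsilon_iff: "U \<in> clopen_upsets X \<Longrightarrow> U \<in> epsilon X x \<longleftrightarrow> x \<in> U"
  by (simp add: epsilon_def)

lemma epsilon_prime_filter:
  assumes "x \<in> pts X"
  shows "epsilon X x \<in> prime_filters (D_obj X)"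
  using assms unfolding prime_filters_def prime_filter_def
  by (auto simp: epsilon_def clopen_upsets_Int)

text \<open>Reflection of the order is the Priestley separation axiom; with antisymmetry it makes
  \<open>epsilon\<close> injective.\<close>

lemma epsilon_le_iff:
  assumes X: "priestley_space X" and xy: "x \<in> pts X" "y \<in> pts X"
  shows "sle X x y \<longleftrightarrow> epsilon X x \<subseteq> epsilon X y"
proof
  show "epsilon X x \<subseteq> epsilon X y" if "sle X x y"
  proof
    fix U assume "U \<in> epsilon X x"
    then have "U \<in> clopen_upsets X" "x \<in> U" by (simp_all add: epsilon_def)
    then show "U \<in> epsilon X y"
      using clopen_upsetsD(4)[OF _ _ xy(2) that] by (simp add: epsilon_def)
  qed
  show "sle X x y" if "epsilon X x \<subseteq> epsilon X y"
    using priestley_spaceD(3)[OF X xy] that unfolding epsilon_def by blast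
qed

text \<open>A point \<open>x\<close> with \<open>epsilon X x \<noteq> P\<close> either misses some
  \<open>U \<in> P\<close> or lies in some clopen upset \<open>V\<close> outside \<open>P\<close>,
  hence in a set \<open>(pts X - U) \<union> V\<close>, taking \<open>V = {}\<close> or
  \<open>U = pts X\<close> for the other half. Meets and primeness of \<open>P\<close> make this
  family directed, so if \<open>P\<close> came from no point, one member would be all of
  \<open>pts X\<close>. Then \<open>U \<subseteq> V\<close>, against \<open>U \<in> P\<close> and
  \<open>V \<notin> P\<close>.\<close>

lemma epsilon_surj:
  assumes X: "WHB_space X" and P: "P \<in> prime_filters (D_obj X)"
  shows "\<exists>x\<in>pts X. epsilon X x = P"
proof (rule ccontr)
  assume none: "\<not> ?thesis"
  note PD = prime_filtersD[OF P, unfolded D_obj_simps alg_le_D_obj]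
  define \<V> where "\<V> = {(pts X - U) \<union> V | U V. U \<in> P \<and> V \<in> clopen_upsets X \<and> V \<notin> P}"
  have \<V>I: "(pts X - U) \<union> V \<in> \<V>" if "U \<in> P" "V \<in> clopen_upsets X" "V \<notin> P" for U V
    using that unfolding \<V>_def by blast
  have "W \<union> W' \<in> \<V>" if WW': "W \<in> \<V>" "W' \<in> \<V>" for W W'
  proof -
    obtain U V U' V' where *: "W = (pts X - U) \<union> V" "W' = (pts X - U') \<union> V'" "U \<in> P" "U' \<in> P"
      "V \<in> clopen_upsets X" "V' \<in> clopen_upsets X" "V \<notin> P" "V' \<notin> P"
      using WW' unfolding \<V>_def by blast
    then have "W \<union> W' = (pts X - (U \<inter> U')) \<union> (V \<union> V')" by auto
    moreover have "U \<inter> U' \<in> P" by (rule PD(5)[OF *(3,4)])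
    moreover have "V \<union> V' \<notin> P" using PD(6)[OF *(5,6)] *(7,8) by blast
    moreover have "V \<union> V' \<in> clopen_upsets X" by (rule clopen_upsets_Un[OF *(5,6)])
    ultimately show ?thesis using \<V>I by simp
  qed
  moreover have "pts X \<subseteq> \<Union>\<V>"
  proof
    fix x assume x: "x \<in> pts X"
    then have "epsilon X x \<noteq> P" using none by blast
    then obtain U where "U \<in> clopen_upsets X" "x \<notin> U \<and> U \<in> P \<or> x \<in> U \<and> U \<notin> P"
      using PD(1) unfolding epsilon_def by blast
    then consider "U \<in> P" "x \<notin> U" | "U \<in> clopen_upsets X" "U \<notin> P" "x \<in> U" by blast
    then have "\<exists>W\<in>\<V>. x \<in> W"
    proof cases
      case 1
      then have "(pts X - U) \<union> {} \<in> \<V>" using PD(3) by (intro \<V>I) simp_all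
      then show ?thesis by (rule bexI[rotated]) (use 1 x in simp)
    next
      case 2
      then have "(pts X - pts X) \<union> U \<in> \<V>" using PD(2) by (intro \<V>I) simp_all
      then show ?thesis using 2 by blast
    qed
    then show "x \<in> \<Union>\<V>" by blast
  qed
  moreover have "openin (stop X) W" if W: "W \<in> \<V>" for W
  proof -
    obtain U V where "W = (pts X - U) \<union> V" "U \<in> clopen_upsets X" "V \<in> clopen_upsets X"
      using W PD(1) unfolding \<V>_def by blast
    then show ?thesis
      using clopen_in_Un[OF clopen_in_diff[OF clopen_in_topspace]] clopen_upsetsD(1)
      unfolding clopen_in_def by metis
  qed
  moreover have "\<V> \<noteq> {}"
    using \<V>I[OF PD(2) clopen_upsets_bounds(1) PD(3)] by blast
  ultimately obtain W where "W \<in> \<V>" "pts X \<subseteq> W"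
    using directed_cover[of "stop X" "pts X" \<V>] priestley_spaceD(1)[OF WHB_spaceD(1)[OF X]]
    unfolding compact_space_def by metis
  then obtain U V where "U \<in> P" "V \<in> clopen_upsets X" "V \<notin> P" "pts X \<subseteq> (pts X - U) \<union> V"
    unfolding \<V>_def by blast
  moreover from this have "U \<subseteq> V" using PD(1) clopen_upsetsD(3) by blast
  ultimately show False using PD(4) by blast
qed

text \<open>If \<open>y\<close> is not an \<open>R\<close>-successor of \<open>x\<close>, compactness of \<open>R(x)\<close> yields clopen upsets
  \<open>U\<close>, \<open>V\<close> with \<open>R(x) \<inter> U \<subseteq> V\<close>, \<open>y \<in> U\<close> and \<open>y \<notin> V\<close>, so \<open>U \<Rightarrow> V\<close> witnesses that
  \<open>\<epsilon>(y)\<close> is not a successor of \<open>\<epsilon>(x)\<close>.\<close>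

lemma epsilon_R_iff:
  assumes X: "WHB_space X" and xy: "x \<in> pts X" "y \<in> pts X"
  shows "(x, y) \<in> sR X \<longleftrightarrow> (epsilon X x, epsilon X y) \<in> X_R (D_obj X)"
proof
  assume "(x, y) \<in> sR X"
  then show "(epsilon X x, epsilon X y) \<in> X_R (D_obj X)"
    unfolding X_R_iff D_obj_simps using epsilon_prime_filter[OF xy(1)] epsilon_prime_filter[OF xy(2)]
    unfolding epsilon_def imp_R_def rimg_def by blast
next
  assume up: "(epsilon X x, epsilon X y) \<in> X_R (D_obj X)"
  show "(x, y) \<in> sR X"
  proof (rule ccontr)
    assume not: "(x, y) \<notin> sR X"
    define \<V> where "\<V> = {(pts X - U) \<union> V | U V. U \<in> clopen_upsets X \<and> V \<in> clopen_upsets X \<and> y \<in> U \<and> y \<notin> V}"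
    have \<V>I: "(pts X - U) \<union> V \<in> \<V>"
      if "U \<in> clopen_upsets X" "V \<in> clopen_upsets X" "y \<in> U" "y \<notin> V" for U V
      using that unfolding \<V>_def by blast
    have "W \<union> W' \<in> \<V>" if WW': "W \<in> \<V>" "W' \<in> \<V>" for W W'
    proof -
      obtain U V U' V' where *: "W = (pts X - U) \<union> V" "W' = (pts X - U') \<union> V'"
        "U \<in> clopen_upsets X" "V \<in> clopen_upsets X" "y \<in> U" "y \<notin> V"
        "U' \<in> clopen_upsets X" "V' \<in> clopen_upsets X" "y \<in> U'" "y \<notin> V'"
        using WW' unfolding \<V>_def by blast
      then have "W \<union> W' = (pts X - (U \<inter> U')) \<union> (V \<union> V')" by auto
      moreover have "U \<inter> U' \<in> clopen_upsets X" "V \<union> V' \<in> clopen_upsets X"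
        using * by (simp_all add: clopen_upsets_Un clopen_upsets_Int)
      ultimately show ?thesis using \<V>I * by simp
    qed
    moreover have "rimg (sR X) x \<subseteq> \<Union>\<V>"
    proof
      fix z assume "z \<in> rimg (sR X) x"
      then have z: "z \<in> pts X" "z \<noteq> y"
        using not WHB_frameD(1)[OF WHB_spaceD(2)[OF X]] by (auto simp: rimg_def)
      \<comment> \<open>By antisymmetry one of the two inclusions fails; which one decides whether
        \<open>z\<close> is covered by an upset \<open>V\<close> avoiding \<open>y\<close> or by the
        complement of an upset \<open>U\<close> containing \<open>y\<close>.\<close>
      then consider "\<not> epsilon X z \<subseteq> epsilon X y" | "\<not> epsilon X y \<subseteq> epsilon X z"
        using epsilon_le_iff[OF WHB_spaceD(1)[OF X]] xy(2) priestley_spaceD(2)[OF WHB_spaceD(1)[OF X]]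
        by metis
      then have "\<exists>W\<in>\<V>. z \<in> W"
      proof cases
        case 1
        then obtain V where V: "V \<in> clopen_upsets X" "z \<in> V" "y \<notin> V" by (auto simp: epsilon_def)
        then have "(pts X - pts X) \<union> V \<in> \<V>" using xy by (intro \<V>I) simp_all
        then show ?thesis using V by blast
      next
        case 2
        then obtain U where U: "U \<in> clopen_upsets X" "y \<in> U" "z \<notin> U" by (auto simp: epsilon_def)
        then have "(pts X - U) \<union> {} \<in> \<V>" by (intro \<V>I) simp_all
        then show ?thesis by (rule bexI[rotated]) (use U z in simp)
      qed
      then show "z \<in> \<Union>\<V>" by blast
    qed
    moreover have "openin (stop X) W" if W: "W \<in> \<V>" for W
    proof -
      obtain U V where "W = (pts X - U) \<union> V" "U \<in> clopen_upsets X" "V \<in> clopen_upsets X"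
        using W unfolding \<V>_def by blast
      then show ?thesis
        using clopen_in_Un[OF clopen_in_diff[OF clopen_in_topspace]] clopen_upsetsD(1)
        unfolding clopen_in_def by metis
    qed
    moreover have "\<V> \<noteq> {}"
      using \<V>I[OF clopen_upsets_bounds(2,1) xy(2)] by blast
    moreover have "compactin (stop X) (rimg (sR X) x)"
      using priestley_spaceD(1)[OF WHB_spaceD(1)[OF X]] WHB_spaceD(3)[OF X] xy(1) by (simp add: closedin_compact_space)
    ultimately obtain W where "W \<in> \<V>" "rimg (sR X) x \<subseteq> W"
      using directed_cover[of "stop X" "rimg (sR X) x" \<V>] by metis
    then obtain U V where UV: "U \<in> clopen_upsets X" "V \<in> clopen_upsets X" "y \<in> U" "y \<notin> V"
      "rimg (sR X) x \<subseteq> (pts X - U) \<union> V" unfolding \<V>_def by blast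
    then have "imp_R X U V \<in> epsilon X x"
      using xy(1) imp_R_clopen_upset[OF X] by (auto simp: epsilon_def imp_R_def)
    moreover have "U \<in> epsilon X y" "V \<notin> epsilon X y" using UV by (simp_all add: mem_epsilon_iff)
    ultimately show False using up UV(1,2) unfolding X_R_iff D_obj_simps by blast
  qed
qed

text \<open>Continuity of the inverse comes for free: \<open>epsilon X\<close> is a continuous
  bijection from a compact space onto the Hausdorff space of prime filters.\<close>

lemma space_iso_epsilon:
  assumes X: "WHB_space X"
  shows "space_iso (epsilon X) X (X_obj (D_obj X))"
proof (rule space_isoI)
  let ?A = "D_obj X"
  note A = WHB_algebra_D_obj[OF X]
  interpret bounded_distrib_lattice ?A using WHB_algebraD(3)[OF A] .
  have "continuous_map (stop X) (X_top ?A) (epsilon X)"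
    unfolding X_top_def
  proof (rule continuous_on_generated_topo)
    have eq: "epsilon X -` sigma ?A U \<inter> pts X = U" if "U \<in> clopen_upsets X" for U
      using that clopen_upsetsD(3)[OF that] by (auto simp: sigma_def mem_epsilon_iff epsilon_prime_filter)
    fix W assume "W \<in> insert (prime_filters ?A) (sigma ?A ` acar ?A \<union> (\<lambda>a. prime_filters ?A - sigma ?A a) ` acar ?A)"
    then consider "W = prime_filters ?A" | U where "U \<in> clopen_upsets X" "W = sigma ?A U"
      | U where "U \<in> clopen_upsets X" "W = prime_filters ?A - sigma ?A U"
      unfolding D_obj_simps by blast
    then show "openin (stop X) (epsilon X -` W \<inter> pts X)"
    proof cases
      case 1
      then have "epsilon X -` W \<inter> pts X = pts X"
        using epsilon_prime_filter[of _ X] by blast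
      then show ?thesis using openin_topspace by metis
    next
      case 2
      then show ?thesis using eq clopen_upsetsD(2) by metis
    next
      case 3
      then have "epsilon X -` W \<inter> pts X = pts X - U"
        by (auto simp: sigma_def mem_epsilon_iff epsilon_prime_filter)
      then show ?thesis using clopen_in_diff[OF clopen_in_topspace clopen_upsetsD(1)[OF 3(1)]]
        by (simp add: clopen_in_def)
    qed
  qed (auto simp: epsilon_prime_filter)
  moreover have "epsilon X ` pts X = prime_filters ?A"
  proof (intro subset_antisym subsetI)
    fix P assume "P \<in> prime_filters ?A"
    then obtain x where "x \<in> pts X" "epsilon X x = P" using epsilon_surj[OF X] by metis
    then show "P \<in> epsilon X ` pts X" by blast
  qed (auto simp: epsilon_prime_filter)
  moreover have "inj_on (epsilon X) (pts X)"
  proof (rule inj_onI)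
    fix x y assume "x \<in> pts X" "y \<in> pts X" "epsilon X x = epsilon X y"
    then show "x = y"
      using epsilon_le_iff[OF WHB_spaceD(1)[OF X]] priestley_spaceD(2)[OF WHB_spaceD(1)[OF X]]
      by (metis subset_refl)
  qed
  ultimately show "homeomorphic_map (stop X) (stop (X_obj ?A)) (epsilon X)"
    using priestley_spaceD(1)[OF WHB_spaceD(1)[OF X]] Hausdorff_priestley_space[OF priestley_space_X_obj]
    by (simp add: continuous_imp_homeomorphic_map)
  show "WHB_frame (X_obj ?A)" by (rule WHB_spaceD(2)[OF WHB_space_X_obj[OF A]])
qed (simp_all add: X WHB_spaceD(2) epsilon_le_iff[OF WHB_spaceD(1)[OF X]] epsilon_R_iff[OF X])

text \<open>The dual equivalence is unfolded into functoriality of both constructions, invertibility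
  of both units and their naturality squares. Morphisms are total functions, meaningful only on
  carriers, so equations between them are asserted on carriers.\<close>

theorem theorem5p7:
  shows
    \<comment> \<open>X is a contravariant functor WHB \<rightarrow> WHBS\<close>
    "(\<forall>A :: 'a alg_sig. WHB_algebra A \<longrightarrow> WHB_space (X_obj A))
   \<and> (\<forall>(A :: 'a alg_sig) (B :: 'b alg_sig) h.
        WHB_algebra A \<and> WHB_algebra B \<and> alg_hom h A B \<longrightarrow>
        WHBS_morphism (X_mor A h) (X_obj B) (X_obj A))
   \<and> (\<forall>A :: 'a alg_sig. WHB_algebra A \<longrightarrow>
        (\<forall>P \<in> pts (X_obj A). X_mor A (\<lambda>a. a) P = P))
   \<and> (\<forall>(A :: 'a alg_sig) (B :: 'b alg_sig) (C :: 'c alg_sig) h g.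
        WHB_algebra A \<and> WHB_algebra B \<and> WHB_algebra C \<and> alg_hom h A B \<and> alg_hom g B C \<longrightarrow>
        (\<forall>P \<in> pts (X_obj C). X_mor A (g \<circ> h) P = X_mor A h (X_mor B g P)))
    \<comment> \<open>D is a contravariant functor WHBS \<rightarrow> WHB\<close>
   \<and> (\<forall>X :: 'x space_sig. WHB_space X \<longrightarrow> WHB_algebra (D_obj X))
   \<and> (\<forall>(X :: 'x space_sig) (Y :: 'y space_sig) f.
        WHB_space X \<and> WHB_space Y \<and> WHBS_morphism f X Y \<longrightarrow>
        alg_hom (D_mor X f) (D_obj Y) (D_obj X))
   \<and> (\<forall>X :: 'x space_sig. WHB_space X \<longrightarrow>
        (\<forall>U \<in> acar (D_obj X). D_mor X (\<lambda>x. x) U = U))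
   \<and> (\<forall>(X :: 'x space_sig) (Y :: 'y space_sig) (Z :: 'z space_sig) f g.
        WHB_space X \<and> WHB_space Y \<and> WHB_space Z \<and> WHBS_morphism f X Y \<and> WHBS_morphism g Y Z \<longrightarrow>
        (\<forall>U \<in> acar (D_obj Z). D_mor X (g \<circ> f) U = D_mor X f (D_mor Y g U)))
    \<comment> \<open>sigma : I \<rightarrow> D \<circ> X is a natural isomorphism\<close>
   \<and> (\<forall>A :: 'a alg_sig. WHB_algebra A \<longrightarrow> alg_iso (sigma A) A (D_obj (X_obj A)))
   \<and> (\<forall>(A :: 'a alg_sig) (B :: 'b alg_sig) h.
        WHB_algebra A \<and> WHB_algebra B \<and> alg_hom h A B \<longrightarrow>
        (\<forall>a \<in> acar A. D_mor (X_obj B) (X_mor A h) (sigma A a) = sigma B (h a)))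
    \<comment> \<open>epsilon : I \<rightarrow> X \<circ> D is a natural isomorphism\<close>
   \<and> (\<forall>X :: 'x space_sig. WHB_space X \<longrightarrow> space_iso (epsilon X) X (X_obj (D_obj X)))
   \<and> (\<forall>(X :: 'x space_sig) (Y :: 'y space_sig) f.
        WHB_space X \<and> WHB_space Y \<and> WHBS_morphism f X Y \<longrightarrow>
        (\<forall>x \<in> pts X. X_mor (D_obj Y) (D_mor X f) (epsilon X x) = epsilon Y (f x)))"
proof (intro conjI allI impI ballI; (elim conjE)?)
  fix A :: "'a alg_sig" and P
  assume "WHB_algebra A"
  then show "WHB_space (X_obj A)" by (rule WHB_space_X_obj)
next
  fix A :: "'a alg_sig" and B :: "'b alg_sig" and h
  assume "WHB_algebra A" "WHB_algebra B" "alg_hom h A B"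
  then show "WHBS_morphism (X_mor A h) (X_obj B) (X_obj A)" by (rule WHBS_morphism_X_mor)
next
  fix A :: "'a alg_sig" and P
  assume "P \<in> pts (X_obj A)"
  then show "X_mor A (\<lambda>a. a) P = P" using prime_filtersD(1)[of P A] by (auto simp: X_mor_def)
next
  fix A :: "'a alg_sig" and B :: "'b alg_sig" and h :: "'a \<Rightarrow> 'b" and g :: "'b \<Rightarrow> 'c" and P
  assume "alg_hom h A B"
  then show "X_mor A (g \<circ> h) P = X_mor A h (X_mor B g P)"
    \<comment> \<open>\<open>X_mor B g P\<close> contains only elements of \<open>acar B\<close>, so
      the iterated preimage agrees with the direct one because \<open>h\<close> maps into that
      carrier.\<close>
    using alg_hom_closed[of h A B] by (auto simp: X_mor_def)
next
  fix X :: "'x space_sig"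
  assume "WHB_space X"
  then show "WHB_algebra (D_obj X)" by (rule WHB_algebra_D_obj)
next
  fix X :: "'x space_sig" and Y :: "'y space_sig" and f
  assume "WHB_space X" "WHBS_morphism f X Y"
  then show "alg_hom (D_mor X f) (D_obj Y) (D_obj X)" by (rule alg_hom_D_mor)
next
  fix X :: "'x space_sig" and U
  assume "U \<in> acar (D_obj X)"
  then show "D_mor X (\<lambda>x. x) U = U" using clopen_upsetsD(3)[of U X] by (auto simp: D_mor_def)
next
  fix X :: "'x space_sig" and Y :: "'y space_sig" and f :: "'x \<Rightarrow> 'y" and g :: "'y \<Rightarrow> 'z" and U
  assume "WHBS_morphism f X Y"
  then show "D_mor X (g \<circ> f) U = D_mor X f (D_mor Y g U)"
    using WHBS_morphismD(7)[of f X Y] by (auto simp: D_mor_def)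
next
  fix A :: "'a alg_sig"
  assume "WHB_algebra A"
  then show "alg_iso (sigma A) A (D_obj (X_obj A))" by (rule alg_iso_sigma)
next
  fix A :: "'a alg_sig" and B :: "'b alg_sig" and h a
  assume "WHB_algebra A" "alg_hom h A B" "a \<in> acar A"
  then show "D_mor (X_obj B) (X_mor A h) (sigma A a) = sigma B (h a)"
    using vimage_X_mor_sigma[OF WHB_algebraD(3)] by (simp add: D_mor_def)
next
  fix X :: "'x space_sig"
  assume "WHB_space X"
  then show "space_iso (epsilon X) X (X_obj (D_obj X))" by (rule space_iso_epsilon)
next
  fix X :: "'x space_sig" and Y :: "'y space_sig" and f x
  assume "WHB_space X" "WHBS_morphism f X Y" "x \<in> pts X"
  then show "X_mor (D_obj Y) (D_mor X f) (epsilon X x) = epsilon Y (f x)"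
    \<comment> \<open>Membership in \<open>epsilon X x\<close> includes being a clopen upset, which
      for the preimage under \<open>f\<close> is the closure part of
      \<open>alg_hom_D_mor\<close>.\<close>
    using alg_hom_closed[OF alg_hom_D_mor[of X f Y]] by (auto simp: X_mor_def epsilon_def D_mor_def)
qed

end
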